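(* Let $\mathbb{F}$ be a quadratically closed field with $\operatorname{char}\mathbb{F}\neq 2$, and let $n\ge 3$. Then $$\mathscr{P}(H_n(\mathbb{F}))=(H_n(\mathbb{F})\setminus\mathbb{F}I_n)\cup\{0,I_n\},$$ and $$1+\lceil\log_2 n\rceil\le w(H_n(\mathbb{F}))\le 4n-4.$$ Furthermore, every nonscalar diagonalizable $A\in H_n(\mathbb{F})$ satisfies $$\ell_{H_n(\mathbb{F})}(A)\le 3\lceil\log_2 n\rceil.$$
   Context: A field of characteristic $\neq2$ is quadratically closed if every polynomial of degree two over it has a root in it (equivalently, every element is a square). $H_n(\mathbb{F})=\{A\in M_n(\mathbb{F}):A^t=A\}$ is the Jordan algebra of symmetric matrices with product $A\circ B=\frac12(AB+BA)$ and unit $I_n$. Nonscalar means not in $\mathbb{F}I_n$; diagonalizable means diagonalizable over $\mathbb{F}$ (by an invertible matrix). Idempotent words: let $\mathcal{J}$ be a unital Jordan algebra with product $\circ$. An idempotent is $e\in\mathcal{J}$ with $e\circ e=e$. An idempotent word of length $m\ge 1$ is a left-nested product $(\cdots((e_1\circ e_2)\circ e_3)\circ\cdots)\circ e_m$ with all $e_i$ idempotents of $\mathcal{J}$ (for $m=1$ it is $e_1$). $\mathscr{P}(\mathcal{J})$ is the set of all values of idempotent words. For $x\in\mathscr{P}(\mathcal{J})$, $\ell_{\mathcal{J}}(x)$ is the minimal length of an idempotent word with value $x$, and $w(\mathcal{J})=\sup_{x\in\mathscr{P}(\mathcal{J})}\ell_{\mathcal{J}}(x)$. *)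

theory Defs
  imports
    Complex_Main
    "HOL-Library.Extended_Nat"
    "HOL-Computational_Algebra.Computational_Algebra"
    "Jordan_Normal_Form.Matrix"
begin

definition quadratically_closed :: "'a::field itself \<Rightarrow> bool" where
  "quadratically_closed _ \<longleftrightarrow>
     (\<forall>p :: 'a poly. degree p = 2 \<longrightarrow> (\<exists>x. poly p x = 0))"

section \<open>Idempotent words\<close>

text \<open>An algebra is given by its carrier \<open>J\<close> and its (not necessarily associative) product
  \<open>f\<close>; the notions below use neither its linear structure nor its unit.\<close>

definition idempotents :: "'b set \<Rightarrow> ('b \<Rightarrow> 'b \<Rightarrow> 'b) \<Rightarrow> 'b set" where
  "idempotents J f = {e \<in> J. f e e = e}"

text \<open>\<open>foldl f e [e\<^sub>2, \<dots>, e\<^sub>m]\<close> is the left-nested product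
  \<open>f (\<dots> (f (f e e\<^sub>2) e\<^sub>3) \<dots>) e\<^sub>m\<close>, a word of length \<open>m = Suc (length [e\<^sub>2, \<dots>, e\<^sub>m])\<close>.\<close>

definition idem_word_value :: "'b set \<Rightarrow> ('b \<Rightarrow> 'b \<Rightarrow> 'b) \<Rightarrow> nat \<Rightarrow> 'b \<Rightarrow> bool" where
  "idem_word_value J f m x \<longleftrightarrow>
     (\<exists>e es. e \<in> idempotents J f \<and> set es \<subseteq> idempotents J f \<and>
             m = Suc (length es) \<and> x = foldl f e es)"

definition idem_products :: "'b set \<Rightarrow> ('b \<Rightarrow> 'b \<Rightarrow> 'b) \<Rightarrow> 'b set" where
  "idem_products J f = {x. \<exists>m. idem_word_value J f m x}"

text \<open>The infimum is the minimum on \<open>idem_products J f\<close>, and \<open>\<infinity>\<close> off that set.\<close>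

definition idem_length :: "'b set \<Rightarrow> ('b \<Rightarrow> 'b \<Rightarrow> 'b) \<Rightarrow> 'b \<Rightarrow> enat" where
  "idem_length J f x = (INF m \<in> {m. idem_word_value J f m x}. enat m)"

definition idem_width :: "'b set \<Rightarrow> ('b \<Rightarrow> 'b \<Rightarrow> 'b) \<Rightarrow> enat" where
  "idem_width J f = (SUP x \<in> idem_products J f. idem_length J f x)"

section \<open>The Jordan algebra of symmetric matrices\<close>

definition sym_mats :: "nat \<Rightarrow> 'a::field mat set" where
  "sym_mats n = {A \<in> carrier_mat n n. transpose_mat A = A}"

definition jordan_mult :: "'a::field mat \<Rightarrow> 'a mat \<Rightarrow> 'a mat" where
  "jordan_mult A B = (1 / 2) \<cdot>\<^sub>m (A * B + B * A)"

definition scalar_mats :: "nat \<Rightarrow> 'a::field mat set" where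
  "scalar_mats n = range (\<lambda>c. c \<cdot>\<^sub>m 1\<^sub>m n)"

text \<open>The conjugating matrix in \<^const>\<open>similar_mat\<close> is any invertible matrix over the same
  field; it is not required to be orthogonal.\<close>

definition diagonalizable_mat :: "'a::field mat \<Rightarrow> bool" where
  "diagonalizable_mat A \<longleftrightarrow> (\<exists>D. diagonal_mat D \<and> similar_mat A D)"

lemma transpose_smult: "(c \<cdot>\<^sub>m A)\<^sup>T = c \<cdot>\<^sub>m A\<^sup>T"
  by (intro eq_matI) auto

lemma sym_mats_jordan_mult:
  assumes "A \<in> sym_mats n" "B \<in> sym_mats n"
  shows "jordan_mult A B \<in> sym_mats n"
proof -
  have c: "A \<in> carrier_mat n n" "B \<in> carrier_mat n n" "A\<^sup>T = A" "B\<^sup>T = B"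
    using assms by (auto simp: sym_mats_def)
  have "(A * B + B * A)\<^sup>T = B * A + A * B"
    using c by (simp add: transpose_add[of _ n n] transpose_mult[of _ n n _ n])
  also have "\<dots> = A * B + B * A"
    using c by (intro comm_add_mat[of _ n n]) auto
  finally show ?thesis
    using c by (auto simp: sym_mats_def jordan_mult_def transpose_smult)
qed

end

theory Submission
  imports
    Defs
    "Jordan_Normal_Form.Determinant"
begin

text \<open>Write \<open>f = 1 - e\<close> for an idempotent \<open>e\<close>. In the Peirce decomposition of \<open>e\<close>, multiplication by \<open>e\<close>
keeps the \<open>e\<close>-corner, halves the off-diagonal part and kills the \<open>f\<close>-corner. Hence \<open>A = X \<circ> e\<close> is
solvable for \<open>X\<close> exactly when \<open>f A f = 0\<close>, and then the \<open>f\<close>-corner of \<open>X\<close> is free while the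
off-diagonal part of \<open>A\<close> gets doubled. Everything is proved by reading words backwards: a word of
length \<open>k + 1\<close> for \<open>A\<close> is a sequence of \<open>k\<close> such ``peeling'' steps from \<open>A\<close> to an idempotent. Only
steps whose \<open>f\<close> has rank at most one in each block are used: on a unit vector \<open>v\<close> with \<open>v\<^sup>T A v = 0\<close>
the new value of the form at \<open>v\<close> can be prescribed (\<open>peels_bordered\<close>). Lengths are invariant under
orthogonal conjugation, and steps on the blocks of a direct sum run in parallel, so matrices are
moved freely to convenient orthonormal bases.

\<^emph>\<open>Scalars.\<close> If \<open>X \<circ> e = c 1\<close> then \<open>0 = f (X \<circ> e) f = c f\<close>, so \<open>c = 0\<close> or \<open>e = 1\<close>; by induction on
the word only the scalars 0 and 1 occur (\<open>scalar_word\<close>).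

\<^emph>\<open>Lower bound.\<close> If \<open>A + 1\<close> has rank at most \<open>r\<close> and \<open>A = X \<circ> e\<close>, then \<open>X + 1\<close> has rank at most
\<open>2 r\<close> (\<open>rank_doubling\<close>). For an idempotent \<open>e\<close> the matrix \<open>e + 1\<close> is invertible, so a word for a
matrix with \<open>A + 1\<close> of rank one has length at least \<open>1 + log\<^sub>2 n\<close>.

\<^emph>\<open>Diagonalizable matrices.\<close> A diagonalizable symmetric matrix is orthogonally diagonalizable
(\<open>diagonalizable_orthogonally\<close>), so it is a list of eigenvalues. Two peeling steps in a plane turn any
pair of distinct eigenvalues into any other such pair, in particular into 0, 1 (\<open>pair_peels\<close>). One
such double step pairs off distinct eigenvalues outside \<open>{0, 1}\<close>; afterwards all eigenvalues outside
\<open>{0, 1}\<close> coincide, and each double step pairs them with the zeros and ones present, whose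
number therefore doubles. So \<open>K = \<lceil>log\<^sub>2 n\<rceil>\<close> double steps reach an idempotent, and the length is at most
\<open>2 K + 1 \<le> 3 K\<close> (\<open>nonconstant_idem_word\<close>).

\<^emph>\<open>General matrices.\<close> A nonscalar \<open>A\<close> has a unit vector \<open>v\<close> with \<open>v\<^sup>T A v = 0\<close>, unless it is a
traceless matrix of size two (\<open>nonscalar_isotropic\<close>). After the corresponding step, the free entry can be chosen
so that a prescribed generic number becomes an eigenvalue with a nonisotropic eigenvector, which
splits off a block of size one and leaves a block of nonzero trace (\<open>isotropic_reduction\<close>).
After one step that makes the trace nonzero, if necessary, \<open>n - 1\<close> steps give a
nonscalar diagonal matrix (\<open>nonscalar_peels_to_diagonal\<close>), so the length is at most
\<open>n + 2 K + 1 \<le> 4 n - 4\<close>.\<close>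

no_notation fps_nth (infixl "$" 75)

section \<open>Orthogonal conjugation\<close>

definition orth :: "nat \<Rightarrow> 'a::field mat set" where
  "orth n = {P \<in> carrier_mat n n. P\<^sup>T * P = 1\<^sub>m n}"

definition conjugate_by :: "'a::field mat \<Rightarrow> 'a mat \<Rightarrow> 'a mat" where
  "conjugate_by P A = P * A * P\<^sup>T"

lemma orth_carrier: "P \<in> orth n \<Longrightarrow> P \<in> carrier_mat n n"
  by (simp add: orth_def)

lemma orth_right: "P \<in> orth n \<Longrightarrow> P * P\<^sup>T = 1\<^sub>m n"
  by (auto simp: orth_def intro: mat_mult_left_right_inverse[of "P\<^sup>T" n P])

lemma orth_transpose: "P \<in> orth n \<Longrightarrow> P\<^sup>T \<in> orth n"
  using orth_right by (auto simp: orth_def)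

lemma orth_one: "1\<^sub>m n \<in> orth n"
  by (simp add: orth_def)

lemma orth_mult:
  assumes "P \<in> orth n" "Q \<in> orth n"
  shows "P * Q \<in> orth n"
proof -
  have c: "P \<in> carrier_mat n n" "Q \<in> carrier_mat n n" using assms by (auto simp: orth_def)
  have "(P * Q)\<^sup>T * (P * Q) = (Q\<^sup>T * P\<^sup>T) * (P * Q)"
    using c by (simp add: transpose_mult[of _ n n _ n])
  also have "\<dots> = Q\<^sup>T * ((P\<^sup>T * P) * Q)"
    using c by (simp add: assoc_mult_mat[of _ n n _ n _ n])
  also have "\<dots> = 1\<^sub>m n" using assms c by (simp add: orth_def)
  finally show ?thesis using c by (simp add: orth_def)
qed

lemma conjugate_by_one: "A \<in> carrier_mat n n \<Longrightarrow> conjugate_by (1\<^sub>m n) A = A"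
  by (simp add: conjugate_by_def)

lemma conjugate_by_conjugate_by:
  assumes "P \<in> carrier_mat n n" "Q \<in> carrier_mat n n" "A \<in> carrier_mat n n"
  shows "conjugate_by P (conjugate_by Q A) = conjugate_by (P * Q) A"
  using assms by (simp add: conjugate_by_def transpose_mult[of _ n n _ n] assoc_mult_mat[of _ n n _ n _ n])

lemma conjugate_by_transpose_cancel:
  assumes "P \<in> orth n" "A \<in> carrier_mat n n"
  shows "conjugate_by P (conjugate_by P\<^sup>T A) = A" "conjugate_by P\<^sup>T (conjugate_by P A) = A"
proof -
  have "P \<in> carrier_mat n n" using assms by (simp add: orth_def)
  with assms show "conjugate_by P (conjugate_by P\<^sup>T A) = A" "conjugate_by P\<^sup>T (conjugate_by P A) = A"
    using orth_right[OF assms(1)] by (simp_all add: conjugate_by_conjugate_by[of _ n] conjugate_by_one orth_def)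
qed

lemma conjugate_by_mult:
  assumes "P \<in> orth n" "A \<in> carrier_mat n n" "B \<in> carrier_mat n n"
  shows "conjugate_by P (A * B) = conjugate_by P A * conjugate_by P B"
proof -
  have c: "P \<in> carrier_mat n n" using assms by (simp add: orth_def)
  have "conjugate_by P A * conjugate_by P B = P * A * ((P\<^sup>T * P) * B * P\<^sup>T)"
    using assms(2,3) c by (simp add: conjugate_by_def assoc_mult_mat[of _ n n _ n _ n])
  also have "\<dots> = conjugate_by P (A * B)"
    using assms c by (simp add: orth_def conjugate_by_def assoc_mult_mat[of _ n n _ n _ n])
  finally show ?thesis ..
qed

lemma conjugate_by_add:
  assumes "P \<in> carrier_mat n n" "A \<in> carrier_mat n n" "B \<in> carrier_mat n n"
  shows "conjugate_by P (A + B) = conjugate_by P A + conjugate_by P B"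
  using assms by (simp add: conjugate_by_def mult_add_distrib_mat[of _ n n _ n] add_mult_distrib_mat[of _ n n _ _ n])

lemma conjugate_by_smult:
  assumes "P \<in> carrier_mat n n" "A \<in> carrier_mat n n"
  shows "conjugate_by P (c \<cdot>\<^sub>m A) = c \<cdot>\<^sub>m conjugate_by P A"
  using assms by (simp add: conjugate_by_def mult_smult_distrib[of _ n n _ n] mult_smult_assoc_mat[of _ n n _ n])

lemma conjugate_by_jordan_mult:
  assumes "P \<in> orth n" "A \<in> carrier_mat n n" "B \<in> carrier_mat n n"
  shows "conjugate_by P (jordan_mult A B) = jordan_mult (conjugate_by P A) (conjugate_by P B)"
proof -
  have c: "P \<in> carrier_mat n n" using assms by (simp add: orth_def)
  show ?thesis using assms c
    by (simp add: jordan_mult_def conjugate_by_smult[of _ n] conjugate_by_add[of _ n] conjugate_by_mult[of _ n])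
qed

lemma sym_mats_carrier: "A \<in> sym_mats n \<Longrightarrow> A \<in> carrier_mat n n"
  by (simp add: sym_mats_def)

lemma sym_mats_index:
  assumes "A \<in> sym_mats n" "i < n" "j < n"
  shows "A $$ (i, j) = A $$ (j, i)"
proof -
  have "A\<^sup>T $$ (i, j) = A $$ (j, i)" using assms by (intro index_transpose_mat) (auto simp: sym_mats_def)
  then show ?thesis using assms by (simp add: sym_mats_def)
qed

lemma conjugate_by_sym_mats:
  assumes "P \<in> carrier_mat n n" "A \<in> sym_mats n"
  shows "conjugate_by P A \<in> sym_mats n"
  using assms
  by (auto simp: sym_mats_def conjugate_by_def transpose_mult[of _ n n _ n] assoc_mult_mat[of _ n n _ n _ n])

lemma conjugate_by_idempotents:
  assumes "P \<in> orth n" "e \<in> idempotents (sym_mats n) jordan_mult"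
  shows "conjugate_by P e \<in> idempotents (sym_mats n) jordan_mult"
  using assms conjugate_by_jordan_mult[OF assms(1), of e e, symmetric]
  by (auto simp: idempotents_def conjugate_by_sym_mats orth_carrier sym_mats_carrier)

lemma conjugate_by_scalar:
  assumes "P \<in> orth n"
  shows "conjugate_by P (c \<cdot>\<^sub>m 1\<^sub>m n) = c \<cdot>\<^sub>m 1\<^sub>m n"
proof -
  have "P \<in> carrier_mat n n" using assms by (simp add: orth_def)
  then show ?thesis by (simp add: conjugate_by_smult[of _ n]) (simp add: conjugate_by_def orth_right[OF assms])
qed

lemma conjugate_by_scalar_iff:
  assumes "P \<in> orth n" "A \<in> carrier_mat n n"
  shows "conjugate_by P A \<in> scalar_mats n \<longleftrightarrow> A \<in> scalar_mats n"
proof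
  assume "conjugate_by P A \<in> scalar_mats n"
  then obtain c where "conjugate_by P A = c \<cdot>\<^sub>m 1\<^sub>m n" by (auto simp: scalar_mats_def)
  then have "conjugate_by P\<^sup>T (conjugate_by P A) = c \<cdot>\<^sub>m 1\<^sub>m n" using conjugate_by_scalar[OF orth_transpose[OF assms(1)]] by simp
  then show "A \<in> scalar_mats n" using conjugate_by_transpose_cancel(2)[OF assms] by (auto simp: scalar_mats_def)
next
  assume "A \<in> scalar_mats n"
  then show "conjugate_by P A \<in> scalar_mats n" using conjugate_by_scalar[OF assms(1)] by (auto simp: scalar_mats_def)
qed

lemma jordan_mult_self:
  assumes "(2::'a::field) \<noteq> 0" "(A::'a mat) \<in> carrier_mat n n"
  shows "jordan_mult A A = A * A"
proof (rule eq_matI)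
  fix i j assume "i < dim_row (A * A)" "j < dim_col (A * A)"
  then have *: "jordan_mult A A $$ (i, j) = (1 / 2) * ((A * A) $$ (i, j) + (A * A) $$ (i, j))"
    using assms(2) by (simp add: jordan_mult_def del: index_mult_mat(1))
  show "jordan_mult A A $$ (i, j) = (A * A) $$ (i, j)"
    unfolding * using assms(1) by (simp add: field_simps)
qed (use assms in \<open>auto simp: jordan_mult_def\<close>)

definition mat_trace :: "'a::field mat \<Rightarrow> 'a" where
  "mat_trace A = (\<Sum>i<dim_row A. A $$ (i, i))"

lemma mat_trace_mult_commute:
  assumes "A \<in> carrier_mat n m" "B \<in> carrier_mat m n"
  shows "mat_trace (A * B) = mat_trace (B * A)"
proof -
  have "mat_trace (A * B) = (\<Sum>i<n. \<Sum>k<m. A $$ (i, k) * B $$ (k, i))"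
    using assms by (simp add: mat_trace_def scalar_prod_def atLeast0LessThan)
  also have "\<dots> = (\<Sum>k<m. \<Sum>i<n. B $$ (k, i) * A $$ (i, k))"
    by (subst sum.swap) (simp add: mult.commute)
  also have "\<dots> = mat_trace (B * A)"
    using assms by (simp add: mat_trace_def scalar_prod_def atLeast0LessThan)
  finally show ?thesis .
qed

lemma mat_trace_conjugate_by:
  assumes "P \<in> orth n" "A \<in> carrier_mat n n"
  shows "mat_trace (conjugate_by P A) = mat_trace A"
proof -
  have c: "P \<in> carrier_mat n n" using assms by (simp add: orth_def)
  have "mat_trace (conjugate_by P A) = mat_trace (P\<^sup>T * (P * A))"
    unfolding conjugate_by_def using c assms by (intro mat_trace_mult_commute) auto
  also have "P\<^sup>T * (P * A) = (P\<^sup>T * P) * A"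
    using c assms by (simp add: assoc_mult_mat[of _ n n _ n _ n])
  finally show ?thesis using assms by (simp add: orth_def)
qed

section \<open>Bordered matrices and direct sums\<close>

text \<open>The symmetric block matrix with corner \<open>d\<close>, border \<open>b\<close> and remaining block \<open>A\<close>. The border is a
vector, so that a vector \<open>vCons x w\<close> is mapped by an explicit formula.\<close>

definition bordered :: "'a::field \<Rightarrow> 'a vec \<Rightarrow> 'a mat \<Rightarrow> 'a mat" where
  "bordered d b A = mat (Suc (dim_row A)) (Suc (dim_row A))
     (\<lambda>(i, j). case i of 0 \<Rightarrow> (case j of 0 \<Rightarrow> d | Suc j' \<Rightarrow> b $ j')
                | Suc i' \<Rightarrow> (case j of 0 \<Rightarrow> b $ i' | Suc j' \<Rightarrow> A $$ (i', j')))"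

lemma bordered_index [simp]:
  "bordered d b A $$ (0, 0) = d"
  "j < dim_row A \<Longrightarrow> bordered d b A $$ (0, Suc j) = b $ j"
  "i < dim_row A \<Longrightarrow> bordered d b A $$ (Suc i, 0) = b $ i"
  "i < dim_row A \<Longrightarrow> j < dim_row A \<Longrightarrow> bordered d b A $$ (Suc i, Suc j) = A $$ (i, j)"
  "dim_row (bordered d b A) = Suc (dim_row A)" "dim_col (bordered d b A) = Suc (dim_row A)"
  by (simp_all add: bordered_def)

lemma bordered_eqI:
  assumes "A \<in> carrier_mat m m" "M \<in> carrier_mat (Suc m) (Suc m)"
    and "M $$ (0, 0) = d" "\<And>j. j < m \<Longrightarrow> M $$ (0, Suc j) = b $ j"
    and "\<And>i. i < m \<Longrightarrow> M $$ (Suc i, 0) = b $ i"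
    and "\<And>i j. i < m \<Longrightarrow> j < m \<Longrightarrow> M $$ (Suc i, Suc j) = A $$ (i, j)"
  shows "M = bordered d b A"
proof (rule eq_matI)
  fix i j assume "i < dim_row (bordered d b A)" "j < dim_col (bordered d b A)"
  then show "M $$ (i, j) = bordered d b A $$ (i, j)"
    using assms by (cases i; cases j) auto
qed (use assms in auto)

lemma bordered_sym:
  assumes "A \<in> sym_mats m"
  shows "bordered d b A \<in> sym_mats (Suc m)"
proof -
  have "A \<in> carrier_mat m m" using assms by (simp add: sym_mats_def)
  then have "(bordered d b A)\<^sup>T = bordered d b A"
    using assms by (intro bordered_eqI[of _ m]) (auto simp: sym_mats_index)
  then show ?thesis using assms by (auto simp: sym_mats_def)
qed

lemma sym_mats_bordered:
  assumes "M \<in> sym_mats (Suc m)"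
  obtains b A where "b \<in> carrier_vec m" "A \<in> sym_mats m" "M = bordered (M $$ (0, 0)) b A"
proof
  let ?b = "vec m (\<lambda>j. M $$ (0, Suc j))" and ?A = "mat m m (\<lambda>(i, j). M $$ (Suc i, Suc j))"
  show "?b \<in> carrier_vec m" by simp
  have "?A\<^sup>T = ?A" using sym_mats_index[OF assms] by (intro eq_matI) auto
  then show "?A \<in> sym_mats m" by (simp add: sym_mats_def)
  show "M = bordered (M $$ (0, 0)) ?b ?A"
    using assms by (intro bordered_eqI[of _ m]) (auto simp: sym_mats_def sym_mats_index[OF assms])
qed

lemma mat_trace_bordered: "mat_trace (bordered d b A) = d + mat_trace A"
  unfolding mat_trace_def by (simp add: sum.lessThan_Suc_shift del: sum.lessThan_Suc)

lemma bordered_mult_vec: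
  assumes "A \<in> carrier_mat m m" "b \<in> carrier_vec m" "w \<in> carrier_vec m"
  shows "bordered d b A *\<^sub>v vCons x w = vCons (d * x + b \<bullet> w) (x \<cdot>\<^sub>v b + A *\<^sub>v w)"
proof (rule eq_vecI)
  fix i assume "i < dim_vec (vCons (d * x + b \<bullet> w) (x \<cdot>\<^sub>v b + A *\<^sub>v w))"
  then have i: "i < Suc m" using assms by simp
  have r0: "row (bordered d b A) 0 = vCons d b"
    using assms by (intro eq_vecI) (auto simp: vec_index_vCons gr0_conv_Suc)
  have rS: "row (bordered d b A) (Suc k) = vCons (b $ k) (row A k)" if "k < m" for k
    using that assms by (intro eq_vecI) (auto simp: vec_index_vCons gr0_conv_Suc)
  show "(bordered d b A *\<^sub>v vCons x w) $ i = vCons (d * x + b \<bullet> w) (x \<cdot>\<^sub>v b + A *\<^sub>v w) $ i"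
  proof (cases i)
    case 0
    then show ?thesis using assms by (simp add: r0)
  next
    case (Suc k)
    then show ?thesis using i assms by (simp add: rS mult.commute)
  qed
qed (use assms in auto)

definition direct_sum :: "'a::field mat \<Rightarrow> 'a mat \<Rightarrow> 'a mat" where
  "direct_sum A B = four_block_mat A (0\<^sub>m (dim_row A) (dim_col B)) (0\<^sub>m (dim_row B) (dim_col A)) B"

lemma direct_sum_carrier: "A \<in> carrier_mat n n \<Longrightarrow> B \<in> carrier_mat m m \<Longrightarrow> direct_sum A B \<in> carrier_mat (n + m) (n + m)"
  by (simp add: direct_sum_def)

lemma direct_sum_mult:
  assumes "A \<in> carrier_mat n n" "B \<in> carrier_mat m m" "C \<in> carrier_mat n n" "D \<in> carrier_mat m m"
  shows "direct_sum A B * direct_sum C D = direct_sum (A * C) (B * D)"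
  using assms by (simp add: direct_sum_def mult_four_block_mat[of _ n n _ m _ m _ _ n _ m])

lemma direct_sum_transpose:
  assumes "A \<in> carrier_mat n n" "B \<in> carrier_mat m m"
  shows "(direct_sum A B)\<^sup>T = direct_sum A\<^sup>T B\<^sup>T"
  using assms by (simp add: direct_sum_def transpose_four_block_mat[of _ n n _ m _ m])

lemma direct_sum_add:
  assumes "A \<in> carrier_mat n n" "B \<in> carrier_mat m m" "C \<in> carrier_mat n n" "D \<in> carrier_mat m m"
  shows "direct_sum A B + direct_sum C D = direct_sum (A + C) (B + D)"
  using assms by (simp add: direct_sum_def add_four_block_mat[of _ n n _ m _ m])

lemma direct_sum_smult:
  assumes "A \<in> carrier_mat n n" "B \<in> carrier_mat m m"
  shows "c \<cdot>\<^sub>m direct_sum A B = direct_sum (c \<cdot>\<^sub>m A) (c \<cdot>\<^sub>m B)"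
  using assms by (simp add: direct_sum_def smult_four_block_mat[of _ n n _ m _ m])

lemma direct_sum_jordan_mult:
  assumes "A \<in> carrier_mat n n" "B \<in> carrier_mat m m" "C \<in> carrier_mat n n" "D \<in> carrier_mat m m"
  shows "jordan_mult (direct_sum A B) (direct_sum C D) = direct_sum (jordan_mult A C) (jordan_mult B D)"
  using assms by (simp add: jordan_mult_def direct_sum_mult[of _ n _ m] direct_sum_add[of _ n _ m] direct_sum_smult[of _ n _ m])

lemma direct_sum_one: "direct_sum (1\<^sub>m n) (1\<^sub>m m) = 1\<^sub>m (n + m)"
  by (simp add: direct_sum_def)

lemma direct_sum_orth: "P \<in> orth n \<Longrightarrow> Q \<in> orth m \<Longrightarrow> direct_sum P Q \<in> orth (n + m)"
  by (simp add: orth_def direct_sum_carrier direct_sum_transpose[of _ n _ m] direct_sum_mult[of _ n _ m] direct_sum_one)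

lemma direct_sum_conjugate_by:
  assumes "P \<in> carrier_mat n n" "Q \<in> carrier_mat m m" "A \<in> carrier_mat n n" "B \<in> carrier_mat m m"
  shows "conjugate_by (direct_sum P Q) (direct_sum A B) = direct_sum (conjugate_by P A) (conjugate_by Q B)"
  using assms by (simp add: conjugate_by_def direct_sum_transpose[of _ n _ m] direct_sum_mult[of _ n _ m])

lemma direct_sum_sym: "A \<in> sym_mats n \<Longrightarrow> B \<in> sym_mats m \<Longrightarrow> direct_sum A B \<in> sym_mats (n + m)"
  by (simp add: sym_mats_def direct_sum_carrier direct_sum_transpose[of _ n _ m])

lemma direct_sum_idempotents:
  "e \<in> idempotents (sym_mats n) jordan_mult \<Longrightarrow> f \<in> idempotents (sym_mats m) jordan_mult
    \<Longrightarrow> direct_sum e f \<in> idempotents (sym_mats (n + m)) jordan_mult"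
  by (simp add: idempotents_def direct_sum_sym direct_sum_jordan_mult[of _ n _ m] sym_mats_carrier)

definition diag_list :: "'a::field list \<Rightarrow> 'a mat" where
  "diag_list xs = mat_diag (length xs) (\<lambda>i. xs ! i)"

lemma diag_list_carrier: "diag_list xs \<in> carrier_mat (length xs) (length xs)"
  by (simp add: diag_list_def)

lemma diag_list_sym: "diag_list xs \<in> sym_mats (length xs)"
  unfolding sym_mats_def diag_list_def mat_diag_def by (auto intro!: eq_matI)

lemma diag_list_append: "diag_list (xs @ ys) = direct_sum (diag_list xs) (diag_list ys)"
  by (rule eq_matI) (auto simp: diag_list_def mat_diag_def direct_sum_def nth_append)

lemma bordered_zero_direct_sum:
  assumes "A \<in> carrier_mat m m"
  shows "bordered d (0\<^sub>v m) A = direct_sum (diag_list [d]) A"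
  using assms by (intro bordered_eqI[symmetric, of _ m]) (auto simp: direct_sum_def diag_list_def mat_diag_def)

section \<open>Adapted orthonormal bases\<close>

lemma conjugate_by_transpose_index:
  assumes "P \<in> carrier_mat n n" "A \<in> carrier_mat n n" "i < n" "j < n"
  shows "conjugate_by P\<^sup>T A $$ (i, j) = col P i \<bullet> (A *\<^sub>v col P j)"
proof -
  have "conjugate_by P\<^sup>T A = P\<^sup>T * (A * P)"
    using assms by (simp add: conjugate_by_def assoc_mult_mat[of _ n n _ n _ n])
  moreover have "col (A * P) j = A *\<^sub>v col P j"
    using assms by (intro eq_vecI) auto
  ultimately show ?thesis using assms by simp
qed

lemma quadratically_closed_root:
  fixes u w :: "'a::field"
  assumes "quadratically_closed TYPE('a)"
  shows "\<exists>x. x * x + u * x + w = 0"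
proof -
  have "degree [:w, u, 1:] = 2" by simp
  then obtain x where "poly [:w, u, 1:] x = 0"
    using assms unfolding quadratically_closed_def by blast
  then show ?thesis by (intro exI[of _ x]) (simp add: algebra_simps)
qed

lemma quadratically_closed_square_root:
  fixes w :: "'a::field"
  assumes "quadratically_closed TYPE('a)"
  shows "\<exists>x. x * x = w"
  using quadratically_closed_root[OF assms, of 0 "- w"] by auto

text \<open>The reflection in \<open>w = u - \<sigma> e\<^sub>0\<close> maps \<open>e\<^sub>0\<close> to \<open>\<sigma> u\<close>, where \<open>\<sigma> = \<plusminus>1\<close>. It needs \<open>w\<close> to be
nonisotropic, and \<open>w \<bullet> w = 2 (1 - \<sigma> u\<^sub>0)\<close> vanishes for at most one of the two signs.\<close>

lemma householder:
  fixes u :: "'a::field vec"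
  assumes two: "(2::'a) \<noteq> 0" and u: "u \<in> carrier_vec (Suc m)" "u \<bullet> u = 1"
  shows "\<exists>P \<in> orth (Suc m). col P 0 = u"
proof -
  define n where "n = Suc m"
  have "\<exists>\<sigma>::'a. \<sigma> * \<sigma> = 1 \<and> 1 - \<sigma> * u $ 0 \<noteq> 0"
  proof (cases "u $ 0 = 1")
    case True
    then show ?thesis using two by (intro exI[of _ "-1"]) simp
  next
    case False
    then show ?thesis by (intro exI[of _ 1]) simp
  qed
  then obtain \<sigma> :: 'a where s: "\<sigma> * \<sigma> = 1" "1 - \<sigma> * u $ 0 \<noteq> 0" by blast
  define w where "w i = u $ i - (if i = 0 then \<sigma> else 0)" for i
  define N where "N = 2 * (1 - \<sigma> * u $ 0)"
  define t where "t = 2 / N"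
  have "N \<noteq> 0" using s two by (simp add: N_def)
  then have tN: "t * N = 2" by (simp add: t_def)
  have npos: "0 < n" by (simp add: n_def)
  have dim: "dim_vec u = n" using u by (simp add: n_def)
  have uu: "(\<Sum>k<n. u $ k * u $ k) = 1"
    using u(2) dim by (simp add: scalar_prod_def atLeast0LessThan)
  have ww: "(\<Sum>k<n. w k * w k) = N"
  proof -
    have "(\<Sum>k<n. w k * w k) = (\<Sum>k<n. u $ k * u $ k + (if k = 0 then \<sigma> * \<sigma> - 2 * \<sigma> * u $ 0 else 0))"
      by (intro sum.cong) (auto simp: w_def algebra_simps)
    also have "\<dots> = 1 + (\<sigma> * \<sigma> - 2 * \<sigma> * u $ 0)"
      using npos by (simp add: sum.distrib uu)
    finally show ?thesis using s by (simp add: N_def algebra_simps)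
  qed
  define p where "p i j = \<sigma> * ((if i = j then 1 else 0) - t * w i * w j)" for i j :: nat
  define P where "P = mat n n (\<lambda>(i, j). p i j)"
  have "P\<^sup>T * P = 1\<^sub>m n"
  proof (rule eq_matI)
    fix i j assume "i < dim_row (1\<^sub>m n :: 'a mat)" "j < dim_col (1\<^sub>m n :: 'a mat)"
    then have ij: "i < n" "j < n" by auto
    have "(P\<^sup>T * P) $$ (i, j) = (\<Sum>k<n. p k i * p k j)"
      using ij by (simp add: P_def scalar_prod_def atLeast0LessThan)
    also have "\<dots> = (\<Sum>k<n. (if k = i then (if i = j then 1 else 0) - t * w i * w j else 0)
        - (if k = j then t * w i * w j else 0) + t * t * w i * w j * (w k * w k))"
    proof (rule sum.cong)
      fix k
      have "p k i * p k j = (\<sigma> * \<sigma>) * (((if k = i then 1 else 0) - t * w k * w i) * ((if k = j then 1 else 0) - t * w k * w j))"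
        by (simp add: p_def)
      then show "p k i * p k j = (if k = i then (if i = j then 1 else 0) - t * w i * w j else 0)
        - (if k = j then t * w i * w j else 0) + t * t * w i * w j * (w k * w k)"
        unfolding s by (auto simp: algebra_simps)
    qed simp
    also have "\<dots> = (\<Sum>k<n. (if k = i then (if i = j then 1 else 0) - t * w i * w j else 0))
        - (\<Sum>k<n. if k = j then t * w i * w j else 0) + t * t * w i * w j * (\<Sum>k<n. w k * w k)"
      by (simp add: sum.distrib sum_subtractf sum_distrib_left)
    also have "\<dots> = (if i = j then 1 else 0) - 2 * (t * w i * w j) + (t * N) * (t * w i * w j)"
      using ij by (simp add: ww algebra_simps)
    also have "\<dots> = (if i = j then 1 else 0)"
      by (simp add: tN)
    finally show "(P\<^sup>T * P) $$ (i, j) = 1\<^sub>m n $$ (i, j)" using ij by simp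
  qed (auto simp: P_def)
  then have "P \<in> orth n" by (simp add: orth_def P_def)
  moreover have "col P 0 = u"
  proof (rule eq_vecI)
    fix i assume "i < dim_vec u"
    then have i: "i < n" using u by (simp add: n_def)
    have s2: "\<sigma> * (\<sigma> * x) = x" for x using s(1) by (simp flip: mult.assoc)
    have "w 0 * 2 = - (\<sigma> * N)" using s by (simp add: w_def N_def algebra_simps s2)
    then have "w 0 * (t * N) = - (\<sigma> * N)" by (simp only: tN)
    then have "w 0 * t = - \<sigma>" using \<open>N \<noteq> 0\<close> by (simp flip: mult.assoc mult_minus_left)
    moreover have "t * w i * w 0 = w i * (w 0 * t)" by (simp add: algebra_simps)
    ultimately have "t * w i * w 0 = - (\<sigma> * w i)" by simp
    then have "p i 0 = \<sigma> * ((if i = 0 then 1 else 0) + \<sigma> * w i)"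
      unfolding p_def by simp
    also have "\<dots> = u $ i" by (simp add: w_def algebra_simps s2 s)
    finally show "col P 0 $ i = u $ i" using i by (simp add: P_def n_def)
  qed (use u in \<open>auto simp: P_def n_def\<close>)
  ultimately show ?thesis by (auto simp: n_def)
qed

lemma orth_first_column:
  fixes v :: "'a::field vec"
  assumes qc: "quadratically_closed TYPE('a)" and two: "(2::'a) \<noteq> 0"
    and v: "v \<in> carrier_vec (Suc m)" "v \<bullet> v \<noteq> 0"
  obtains P c where "P \<in> orth (Suc m)" "col P 0 = c \<cdot>\<^sub>v v"
proof -
  obtain c where c: "c * c = 1 / (v \<bullet> v)" using quadratically_closed_square_root[OF qc] by blast
  have "(c \<cdot>\<^sub>v v) \<bullet> (c \<cdot>\<^sub>v v) = (c * c) * (v \<bullet> v)"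
    using v by (simp add: mult.assoc)
  also have "\<dots> = 1" using v c by simp
  finally show ?thesis using householder[OF two, of "c \<cdot>\<^sub>v v" m] that v by auto
qed

lemma isotropic_vector_bordered:
  fixes A :: "'a::field mat"
  assumes qc: "quadratically_closed TYPE('a)" and two: "(2::'a) \<noteq> 0"
    and A: "A \<in> sym_mats (Suc m)" and v: "v \<in> carrier_vec (Suc m)" "v \<bullet> v \<noteq> 0" "v \<bullet> (A *\<^sub>v v) = 0"
  obtains P b B where "P \<in> orth (Suc m)" "b \<in> carrier_vec m" "B \<in> sym_mats m" "A = conjugate_by P (bordered 0 b B)"
proof -
  obtain P c where P: "P \<in> orth (Suc m)" "col P 0 = c \<cdot>\<^sub>v v" by (rule orth_first_column[OF qc two v(1,2)])
  note [simp] = orth_carrier[OF P(1)] sym_mats_carrier[OF A]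
  have "conjugate_by P\<^sup>T A $$ (0, 0) = (c \<cdot>\<^sub>v v) \<bullet> (A *\<^sub>v (c \<cdot>\<^sub>v v))"
    using P by (subst conjugate_by_transpose_index[of _ "Suc m"]) auto
  also have "\<dots> = c * (c * (v \<bullet> (A *\<^sub>v v)))"
    using v mult_mat_vec_carrier[OF sym_mats_carrier[OF A] v(1)]
    by (simp add: mult_mat_vec[OF sym_mats_carrier[OF A] v(1)])
  finally have 0: "conjugate_by P\<^sup>T A $$ (0, 0) = 0" using v by simp
  have "conjugate_by P\<^sup>T A \<in> sym_mats (Suc m)" using A by (intro conjugate_by_sym_mats) auto
  then obtain b B where B: "b \<in> carrier_vec m" "B \<in> sym_mats m"
    and "conjugate_by P\<^sup>T A = bordered (conjugate_by P\<^sup>T A $$ (0, 0)) b B"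
    by (rule sym_mats_bordered)
  then have "conjugate_by P\<^sup>T A = bordered 0 b B" unfolding 0 by simp
  then show ?thesis using that[of P b B] B P conjugate_by_transpose_cancel(1)[OF P(1), of A] by simp
qed

text \<open>In an orthonormal basis that starts with the eigenvector, the first column of the matrix is
\<open>l e\<^sub>0\<close>, and by symmetry so is the first row.\<close>

lemma eigenvector_direct_sum:
  fixes A :: "'a::field mat"
  assumes qc: "quadratically_closed TYPE('a)" and two: "(2::'a) \<noteq> 0"
    and A: "A \<in> sym_mats (Suc m)" and v: "v \<in> carrier_vec (Suc m)" "v \<bullet> v \<noteq> 0" "A *\<^sub>v v = l \<cdot>\<^sub>v v"
  obtains P B where "P \<in> orth (Suc m)" "B \<in> sym_mats m" "A = conjugate_by P (direct_sum (diag_list [l]) B)"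
proof -
  obtain P c where P: "P \<in> orth (Suc m)" "col P 0 = c \<cdot>\<^sub>v v" by (rule orth_first_column[OF qc two v(1,2)])
  note [simp] = orth_carrier[OF P(1)] sym_mats_carrier[OF A]
  have eig: "A *\<^sub>v col P 0 = l \<cdot>\<^sub>v col P 0"
    by (simp only: P(2) mult_mat_vec[OF sym_mats_carrier[OF A] v(1)] v(3) smult_smult_assoc mult.commute)
  have col0: "conjugate_by P\<^sup>T A $$ (i, 0) = (if i = 0 then l else 0)" if "i < Suc m" for i
  proof -
    have c: "col P i \<in> carrier_vec (Suc m)" "col P 0 \<in> carrier_vec (Suc m)"
      by (rule col_carrier_vec[OF _ orth_carrier[OF P(1)]], use that in simp)+
    have "conjugate_by P\<^sup>T A $$ (i, 0) = col P i \<bullet> (A *\<^sub>v col P 0)"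
      using that by (intro conjugate_by_transpose_index[of _ "Suc m"]) auto
    also have "\<dots> = l * (col P i \<bullet> col P 0)"
      unfolding eig by (rule scalar_prod_smult_distrib[OF c])
    also have "col P i \<bullet> col P 0 = (P\<^sup>T * P) $$ (i, 0)"
      using that carrier_matD[OF orth_carrier[OF P(1)]] by simp
    also have "\<dots> = (if i = 0 then 1 else 0)"
      using P(1) that by (simp add: orth_def del: index_mult_mat(1))
    also have "l * \<dots> = (if i = 0 then l else 0)" by simp
    finally show ?thesis .
  qed
  have s: "conjugate_by P\<^sup>T A \<in> sym_mats (Suc m)" using A by (intro conjugate_by_sym_mats) auto
  have l: "conjugate_by P\<^sup>T A $$ (0, 0) = l" using col0[of 0] by simp
  obtain b B where B: "b \<in> carrier_vec m" "B \<in> sym_mats m" "conjugate_by P\<^sup>T A = bordered l b B"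
    using sym_mats_bordered[OF s] unfolding l by blast
  have "b $ i = 0" if "i < m" for i
  proof -
    have "bordered l b B $$ (Suc i, 0) = b $ i"
      using that sym_mats_carrier[OF B(2)] by simp
    then show ?thesis using col0[of "Suc i"] that unfolding B(3) by simp
  qed
  then have "b = 0\<^sub>v m" using B(1) by (intro eq_vecI) auto
  then have "conjugate_by P\<^sup>T A = direct_sum (diag_list [l]) B"
    using B(3) bordered_zero_direct_sum[OF sym_mats_carrier[OF B(2)]] by metis
  then have "A = conjugate_by P (direct_sum (diag_list [l]) B)"
    using conjugate_by_transpose_cancel(1)[OF P(1) sym_mats_carrier[OF A]] by metis
  then show ?thesis using that P(1) B(2) by blast
qed

section \<open>Reading words backwards\<close>

abbreviation "sym_idempotents n \<equiv> idempotents (sym_mats n) jordan_mult"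

lemma one_idempotent:
  assumes "(2::'a::field) \<noteq> 0"
  shows "(1\<^sub>m n :: 'a mat) \<in> sym_idempotents n"
  using assms by (simp add: idempotents_def sym_mats_def jordan_mult_self[of _ n])

lemma jordan_mult_one:
  assumes "(2::'a::field) \<noteq> 0" "(A :: 'a mat) \<in> carrier_mat n n"
  shows "jordan_mult A (1\<^sub>m n) = A"
proof -
  show ?thesis using assms by (intro eq_matI) (simp_all add: jordan_mult_def)
qed

text \<open>\<open>A\<close> arises from \<open>X\<close> by \<open>k\<close> multiplications by idempotents, interleaved with conjugations by orthogonal
matrices. The conjugations do not change word lengths; building them into the relation makes it
transitive and compatible with changes of basis at every stage. The index \<open>k\<close> is kept exact because in a
direct sum the blocks are treated simultaneously, by the same number of steps.\<close>

primrec peels :: "nat \<Rightarrow> nat \<Rightarrow> 'a::field mat \<Rightarrow> 'a mat \<Rightarrow> bool" where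
  "peels n 0 A X \<longleftrightarrow> X \<in> sym_mats n \<and> (\<exists>P \<in> orth n. A = conjugate_by P X)"
| "peels n (Suc k) A X \<longleftrightarrow> (\<exists>Y. peels n k Y X \<and> (\<exists>P \<in> orth n. \<exists>e \<in> sym_idempotents n. A = conjugate_by P (jordan_mult Y e)))"

lemma peels_sym: "peels n k A X \<Longrightarrow> A \<in> sym_mats n \<and> X \<in> sym_mats n"
  by (induction k arbitrary: A)
     (auto simp: conjugate_by_sym_mats orth_carrier idempotents_def sym_mats_jordan_mult)

lemma peels_refl: "A \<in> sym_mats n \<Longrightarrow> peels n 0 A A"
  using orth_one[of n] conjugate_by_one[of A n] by (auto simp: sym_mats_carrier intro: bexI[of _ "1\<^sub>m n"])

lemma peels_conjugate_by:
  assumes "peels n k A X" "P \<in> orth n"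
  shows "peels n k (conjugate_by P A) X"
proof -
  have *: "\<exists>Q' \<in> orth n. conjugate_by P (conjugate_by Q B) = conjugate_by Q' B" if "Q \<in> orth n" "B \<in> carrier_mat n n" for Q B
    using orth_mult[OF assms(2) that(1)] conjugate_by_conjugate_by[of P n Q B] that assms(2) by (auto simp: orth_carrier)
  show ?thesis
  proof (cases k)
    case 0
    then show ?thesis using assms(1) * sym_mats_carrier unfolding 0 peels.simps by blast
  next
    case (Suc j)
    then obtain Y Q e where Y: "peels n j Y X" "Q \<in> orth n" "e \<in> sym_idempotents n" "A = conjugate_by Q (jordan_mult Y e)"
      using assms(1) by auto
    have "jordan_mult Y e \<in> carrier_mat n n"
      using Y peels_sym[OF Y(1)] by (intro sym_mats_carrier sym_mats_jordan_mult) (auto simp: idempotents_def)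
    then show ?thesis using *[OF Y(2)] Y unfolding Suc peels.simps by metis
  qed
qed

lemma peels_trans: "peels n j A Y \<Longrightarrow> peels n k Y X \<Longrightarrow> peels n (j + k) A X"
  by (induction j arbitrary: A) (auto simp: peels_conjugate_by)

lemma peels_Suc:
  fixes A :: "'a::field mat"
  assumes "(2::'a) \<noteq> 0" "peels n k A X"
  shows "peels n (Suc k) A X"
proof -
  have "A \<in> carrier_mat n n" using peels_sym[OF assms(2)] by (simp add: sym_mats_carrier)
  then have "A = conjugate_by (1\<^sub>m n) (jordan_mult A (1\<^sub>m n))"
    using assms(1) by (simp add: jordan_mult_one conjugate_by_one)
  then show ?thesis using assms(2) orth_one one_idempotent[OF assms(1)] unfolding peels.simps by blast
qed

lemma peels_mono:
  fixes A :: "'a::field mat"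
  assumes "(2::'a) \<noteq> 0" "peels n j A X" "j \<le> k"
  shows "peels n k A X"
  using assms(3) by (induction rule: dec_induct) (auto simp: assms(2) peels_Suc[OF assms(1)] simp del: peels.simps)

lemma peels_direct_sum:
  "peels n k A X \<Longrightarrow> peels m k B Y \<Longrightarrow> peels (n + m) k (direct_sum A B) (direct_sum X Y)"
proof (induction k arbitrary: A B)
  case 0
  then obtain P Q where "P \<in> orth n" "Q \<in> orth m" "A = conjugate_by P X" "B = conjugate_by Q Y" "X \<in> sym_mats n" "Y \<in> sym_mats m"
    by auto
  then show ?case
    by (auto simp: direct_sum_sym direct_sum_conjugate_by[of _ n _ m] orth_carrier sym_mats_carrier
        intro!: bexI[of _ "direct_sum P Q"] direct_sum_orth)
next
  case (Suc k)
  then obtain A' P e B' Q f where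
    A: "peels n k A' X" "P \<in> orth n" "e \<in> sym_idempotents n" "A = conjugate_by P (jordan_mult A' e)" and
    B: "peels m k B' Y" "Q \<in> orth m" "f \<in> sym_idempotents m" "B = conjugate_by Q (jordan_mult B' f)" by auto
  have s: "A' \<in> sym_mats n" "B' \<in> sym_mats m" "e \<in> sym_mats n" "f \<in> sym_mats m"
    using A B peels_sym by (auto simp: idempotents_def)
  have "conjugate_by (direct_sum P Q) (jordan_mult (direct_sum A' B') (direct_sum e f)) = direct_sum A B"
    using A B s sym_mats_jordan_mult[OF s(1,3)] sym_mats_jordan_mult[OF s(2,4)]
    by (simp add: direct_sum_jordan_mult[of _ n _ m] direct_sum_conjugate_by[of _ n _ m] orth_carrier sym_mats_carrier)
  then show ?case using Suc.IH[OF A(1) B(1)] A B direct_sum_orth direct_sum_idempotents by (metis peels.simps(2))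
qed

lemma idem_word_snoc:
  assumes "idem_word_value J f m x" "e \<in> idempotents J f"
  shows "idem_word_value J f (Suc m) (f x e)"
proof -
  obtain a as where *: "a \<in> idempotents J f" "set as \<subseteq> idempotents J f" "m = Suc (length as)" "x = foldl f a as"
    using assms(1) by (auto simp: idem_word_value_def)
  show ?thesis unfolding idem_word_value_def
    using * assms(2) by (intro exI[of _ a] exI[of _ "as @ [e]"]) auto
qed

text \<open>Words are left-nested, so induction removes the last factor.\<close>

lemma idem_word_induct [consumes 1, case_names idempotent snoc]:
  assumes "idem_word_value J f m x"
    and "\<And>e. e \<in> idempotents J f \<Longrightarrow> Q 1 e"
    and "\<And>m x e. idem_word_value J f m x \<Longrightarrow> Q m x \<Longrightarrow> e \<in> idempotents J f \<Longrightarrow> Q (Suc m) (f x e)"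
  shows "Q m x"
proof -
  obtain a as where a: "a \<in> idempotents J f" and *: "set as \<subseteq> idempotents J f" "m = Suc (length as)" "x = foldl f a as"
    using assms(1) by (auto simp: idem_word_value_def)
  have "Q (Suc (length as)) (foldl f a as)" using *(1)
  proof (induction as rule: rev_induct)
    case Nil
    then show ?case using assms(2)[OF a] by simp
  next
    case (snoc e as)
    then show ?case using assms(3)[of "Suc (length as)" "foldl f a as" e] a
      by (auto simp: idem_word_value_def)
  qed
  with * show ?thesis by simp
qed

lemma idem_word_sym: "idem_word_value (sym_mats n) jordan_mult m A \<Longrightarrow> A \<in> sym_mats n"
  by (induction rule: idem_word_induct) (auto simp: idempotents_def sym_mats_jordan_mult)

lemma idem_word_conjugate_by:
  assumes "idem_word_value (sym_mats n) jordan_mult m A" "P \<in> orth n"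
  shows "idem_word_value (sym_mats n) jordan_mult m (conjugate_by P A)"
  using assms(1)
proof (induction rule: idem_word_induct)
  case (idempotent e)
  then show ?case using conjugate_by_idempotents[OF assms(2)] by (auto simp: idem_word_value_def)
next
  case (snoc m A e)
  then have "conjugate_by P (jordan_mult A e) = jordan_mult (conjugate_by P A) (conjugate_by P e)"
    using idem_word_sym[OF snoc(1)] assms(2)
    by (intro conjugate_by_jordan_mult[of _ n]) (auto simp: sym_mats_carrier idempotents_def)
  then show ?case using idem_word_snoc[OF snoc.IH conjugate_by_idempotents[OF assms(2) snoc(2)]] by simp
qed

lemma peels_idem_word:
  "peels n k A X \<Longrightarrow> idem_word_value (sym_mats n) jordan_mult m X
    \<Longrightarrow> idem_word_value (sym_mats n) jordan_mult (k + m) A"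
  by (induction k arbitrary: A) (auto intro: idem_word_conjugate_by idem_word_snoc)

lemma peels_idempotent:
  "peels n k A X \<Longrightarrow> X \<in> sym_idempotents n \<Longrightarrow> idem_word_value (sym_mats n) jordan_mult (k + 1) A"
  by (erule peels_idem_word) (auto simp: idem_word_value_def)

text \<open>Multiplication by the projection onto the last \<open>m\<close> coordinates kills the corner and halves the
border. Read backwards, a zero corner may be replaced by any \<open>d\<close> if the border is doubled.\<close>

lemma peels_bordered:
  fixes B :: "'a::field mat"
  assumes two: "(2::'a) \<noteq> 0" and B: "B \<in> sym_mats m" and b: "b \<in> carrier_vec m"
  shows "peels (Suc m) 1 (bordered 0 b B) (bordered d (2 \<cdot>\<^sub>v b) B)"
proof -
  let ?X = "bordered d (2 \<cdot>\<^sub>v b) B"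
  let ?f = "\<lambda>i::nat. if i = 0 then 0 else 1 :: 'a"
  let ?e = "mat_diag (Suc m) ?f"
  have B': "B \<in> carrier_mat m m" using B by (simp add: sym_mats_carrier)
  have X: "?X \<in> sym_mats (Suc m)" using B by (rule bordered_sym)
  have Xc: "?X \<in> carrier_mat (Suc m) (Suc m)" using X by (rule sym_mats_carrier)
  have e: "?e \<in> sym_idempotents (Suc m)"
  proof -
    have "?e\<^sup>T = ?e" by (rule eq_matI) (auto simp: mat_diag_def)
    then show ?thesis using two
      by (auto simp: idempotents_def sym_mats_def jordan_mult_self[of _ "Suc m"] intro!: arg_cong[of _ _ "mat_diag _"])
  qed
  have half: "x / 2 + x / 2 = x" for x :: 'a using two by (simp add: field_simps)
  have "jordan_mult ?X ?e = bordered 0 b B"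
    using B' b two
    by (intro bordered_eqI[of _ m])
       (auto simp: jordan_mult_def mat_diag_mult_left[OF Xc] mat_diag_mult_right[OF Xc] add_divide_distrib half)
  moreover have "jordan_mult ?X ?e \<in> carrier_mat (Suc m) (Suc m)"
    using X e by (intro sym_mats_carrier sym_mats_jordan_mult) (auto simp: idempotents_def)
  ultimately have *: "bordered 0 b B = conjugate_by (1\<^sub>m (Suc m)) (jordan_mult ?X ?e)"
    by (simp add: conjugate_by_one)
  have "\<exists>Y. peels (Suc m) 0 Y ?X \<and> (\<exists>P \<in> orth (Suc m). \<exists>e \<in> sym_idempotents (Suc m). bordered 0 b B = conjugate_by P (jordan_mult Y e))"
    by (rule exI[of _ ?X], intro conjI peels_refl X bexI[OF _ orth_one] bexI[OF _ e] *)
  then show ?thesis by (simp only: peels.simps One_nat_def)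
qed

declare peels.simps [simp del]

section \<open>Symmetric matrices of size two\<close>

text \<open>The matrix with rows \<open>(p, q)\<close> and \<open>(q, s)\<close>, as a bordered matrix so that \<open>peels_bordered\<close> applies to it.\<close>

definition sym2 :: "'a::field \<Rightarrow> 'a \<Rightarrow> 'a \<Rightarrow> 'a mat" where
  "sym2 p q s = bordered p (vec 1 (\<lambda>_. q)) (diag_list [s])"

lemma singleton_diag_list:
  assumes "A \<in> sym_mats 1"
  obtains a where "A = diag_list [a]"
proof
  show "A = diag_list [A $$ (0, 0)]"
    using assms by (intro eq_matI) (auto simp: sym_mats_def diag_list_def mat_diag_def)
qed

lemma sym2_sym: "sym2 p q s \<in> sym_mats 2"
  using bordered_sym[OF diag_list_sym[of "[s]"]] by (simp add: sym2_def numeral_2_eq_2)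

lemma diag_list_pair: "diag_list [a, b :: 'a::field] = sym2 a 0 b"
proof -
  have "vec 1 (\<lambda>_. 0 :: 'a) = 0\<^sub>v 1" by (intro eq_vecI) auto
  then show ?thesis
    using bordered_zero_direct_sum[of "diag_list [b]" 1 a] diag_list_append[of "[a]" "[b]"] diag_list_carrier[of "[b]"]
    by (simp add: sym2_def)
qed

lemma sym2_index [simp]:
  "sym2 p q s $$ (0, 0) = p" "sym2 p q s $$ (0, Suc 0) = q"
  "sym2 p q s $$ (Suc 0, 0) = q" "sym2 p q s $$ (Suc 0, Suc 0) = s"
  "dim_row (sym2 p q s) = 2" "dim_col (sym2 p q s) = 2"
  by (simp_all add: sym2_def diag_list_def mat_diag_def)

lemma mat_trace_sym2: "mat_trace (sym2 p q s) = p + s"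
  by (simp add: mat_trace_def numeral_2_eq_2)

lemma mat_trace_sym2_square: "mat_trace (sym2 p q s * sym2 p q s) = p * p + 2 * (q * q) + s * s"
  by (simp add: mat_trace_def numeral_2_eq_2 scalar_prod_def)

lemma sym2_mult_vec:
  "sym2 p q s *\<^sub>v vec 2 (\<lambda>i. if i = 0 then x else y) = vec 2 (\<lambda>i. if i = 0 then p * x + q * y else q * x + s * y)"
  by (rule eq_vecI) (auto simp: scalar_prod_def numeral_2_eq_2 less_Suc_eq)

lemma vec2_scalar_prod:
  "vec 2 (\<lambda>i. if i = 0 then x else y) \<bullet> vec 2 (\<lambda>i. if i = 0 then x' else y') = x * x' + y * (y' :: 'a::field)"
  by (simp add: scalar_prod_def numeral_2_eq_2)

text \<open>The zeros of a nonzero binary form are at most two lines. If all of them are isotropic for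
\<open>x\<^sup>2 + y\<^sup>2\<close>, then the form is a multiple of \<open>x\<^sup>2 + y\<^sup>2\<close> (the two isotropic lines; a scalar matrix) or
of the square of an isotropic linear form (one of them twice; a nilpotent matrix).\<close>

lemma binary_form_zero:
  fixes p q s :: "'a::field"
  assumes qc: "quadratically_closed TYPE('a)" and two: "(2::'a) \<noteq> 0"
    and nonscalar: "\<not> (p = s \<and> q = 0)" and nonnilpotent: "\<not> (p + s = 0 \<and> q * q = p * s)"
  shows "\<exists>x y. p * x * x + 2 * q * x * y + s * y * y = 0 \<and> x * x + y * y \<noteq> 0"
proof (cases "p = 0 \<or> s = 0")
  case True
  then show ?thesis
  proof
    assume "p = 0"
    then show ?thesis by (intro exI[of _ 1] exI[of _ 0]) simp
  next
    assume "s = 0"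
    then show ?thesis by (intro exI[of _ 0] exI[of _ 1]) simp
  qed
next
  case False
  then have p: "p \<noteq> 0" by simp
  obtain x where "x * x + (2 * q / p) * x + s / p = 0"
    using quadratically_closed_root[OF qc] by blast
  then have "p * (x * x + (2 * q / p) * x + s / p) = 0" by simp
  then have x: "p * x * x + 2 * q * x + s = 0" using p by (simp add: algebra_simps)
  \<comment> \<open>the second root of the dehomogenised form, by Vieta\<close>
  define y where "y = - (2 * q / p) - x"
  have y1: "p * (x + y) = - 2 * q" using p by (simp add: y_def algebra_simps)
  have y2: "p * (x * y) = s"
  proof -
    have "p * (x * y) - s = x * (p * (x + y) + 2 * q) - (p * x * x + 2 * q * x + s)" by (simp add: algebra_simps)
    then show ?thesis unfolding x y1 by simp
  qed
  have y: "p * y * y + 2 * q * y + s = 0"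
  proof -
    have "p * y * y + 2 * q * y + s = y * (p * (x + y)) - p * (x * y) + 2 * q * y + s" by (simp add: algebra_simps)
    then show ?thesis unfolding y1 y2 by simp
  qed
  show ?thesis
  proof (cases "x * x + 1 \<noteq> 0 \<or> y * y + 1 \<noteq> 0")
    case True
    then show ?thesis
    proof
      assume "x * x + 1 \<noteq> 0"
      then show ?thesis using x by (intro exI[of _ x] exI[of _ 1]) simp
    next
      assume "y * y + 1 \<noteq> 0"
      then show ?thesis using y by (intro exI[of _ y] exI[of _ 1]) simp
    qed
  next
    case False
    then have xx: "x * x = - 1" and yy: "y * y = - 1" by (simp_all add: eq_neg_iff_add_eq_0)
    then have "(x - y) * (x + y) = 0" by (simp add: algebra_simps)
    then have "x = y \<or> x + y = 0" by simp
    then show ?thesis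
    proof
      assume e: "x = y"
      have s: "s = - p" using y2 e xx by simp
      have "2 * (p * x) = 2 * (- q)" using y1 e by (simp add: algebra_simps)
      then have "p * x = - q" using two by (metis mult_left_cancel)
      then have "q * q = (p * x) * (p * x)" by simp
      also have "\<dots> = p * p * (x * x)" by (simp add: algebra_simps)
      finally show ?thesis using nonnilpotent s xx by simp
    next
      assume e: "x + y = 0"
      then have "q = 0" using y1 two by simp
      moreover have "y = - x" using e by (simp add: eq_neg_iff_add_eq_0 add.commute)
      then have "s = p" using y2 xx by simp
      ultimately show ?thesis using nonscalar by simp
    qed
  qed
qed

text \<open>In a basis with a zero corner, the trace and the determinant determine the remaining entries:
the second diagonal entry is the trace, and the square of the off-diagonal entry is minus the
determinant. So one step changes trace \<open>t\<close> and determinant \<open>\<delta>\<close> to \<open>t'\<close> and \<open>t (t' - t) + 4 \<delta>\<close>, where \<open>t'\<close>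
is arbitrary.\<close>

lemma peels_sym2:
  fixes p q s :: "'a::field"
  assumes qc: "quadratically_closed TYPE('a)" and two: "(2::'a) \<noteq> 0"
    and ns: "\<not> (p = s \<and> q = 0)" "\<not> (p + s = 0 \<and> q * q = p * s)"
  obtains b where "b * b = q * q - p * s" "\<And>d. peels 2 1 (sym2 p q s) (sym2 d (2 * b) (p + s))"
proof -
  obtain x y where xy: "p * x * x + 2 * q * x * y + s * y * y = 0" "x * x + y * y \<noteq> 0"
    using binary_form_zero[OF qc two ns] by blast
  let ?A = "sym2 p q s" and ?v = "vec 2 (\<lambda>i. if i = 0 then x else y)"
  have v: "?v \<bullet> ?v \<noteq> 0" "?v \<bullet> (?A *\<^sub>v ?v) = 0"
    unfolding sym2_mult_vec vec2_scalar_prod using xy by (simp_all add: algebra_simps)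
  have vc: "?v \<in> carrier_vec (Suc 1)" by (simp add: numeral_2_eq_2)
  have A: "?A \<in> sym_mats (Suc 1)" using sym2_sym by (simp add: numeral_2_eq_2)
  obtain P b B where P: "P \<in> orth (Suc 1)" "b \<in> carrier_vec 1" "B \<in> sym_mats 1" "?A = conjugate_by P (bordered 0 b B)"
    by (rule isotropic_vector_bordered[OF qc two A vc v])
  obtain c where c: "B = diag_list [c]" by (rule singleton_diag_list[OF P(3)])
  define b0 where "b0 = b $ 0"
  have b: "b = vec 1 (\<lambda>_. b0)" using P(2) by (intro eq_vecI) (auto simp: b0_def)
  have AP: "?A = conjugate_by P (sym2 0 b0 c)" using P(4) by (simp add: sym2_def b c)
  have P2: "P \<in> orth 2" using P(1) by (simp add: numeral_2_eq_2)
  note car = sym_mats_carrier[OF sym2_sym]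
  have "mat_trace ?A = mat_trace (sym2 0 b0 c)"
    unfolding AP by (rule mat_trace_conjugate_by[OF P2 car])
  then have c_eq: "c = p + s" by (simp add: mat_trace_sym2)
  \<comment> \<open>The trace of the square serves as the second invariant in place of the determinant.\<close>
  have "mat_trace (?A * ?A) = mat_trace (sym2 0 b0 c * sym2 0 b0 c)"
    unfolding AP conjugate_by_mult[OF P2 car car, symmetric] by (intro mat_trace_conjugate_by[OF P2]) (intro mult_carrier_mat[of _ 2 2] car)
  then have "2 * (b0 * b0) = 2 * (q * q - p * s)"
    by (simp add: mat_trace_sym2_square c_eq algebra_simps)
  then have 1: "b0 * b0 = q * q - p * s" using two by (metis mult_left_cancel)
  have "peels 2 1 ?A (sym2 d (2 * b0) (p + s))" for d
  proof -
    have "2 \<cdot>\<^sub>v b = vec 1 (\<lambda>_. 2 * b0)" unfolding b by (intro eq_vecI) auto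
    then have "peels (Suc 1) 1 (bordered 0 b B) (sym2 d (2 * b0) (p + s))"
      using peels_bordered[OF two P(3,2), of d] by (simp add: sym2_def c c_eq)
    from peels_conjugate_by[OF this P(1)] show ?thesis
      unfolding P(4)[symmetric] by (simp add: numeral_2_eq_2)
  qed
  with 1 show ?thesis using that by blast
qed

text \<open>The vectors \<open>(q, a - p)\<close> and \<open>(a - s, q)\<close> are eigenvectors for \<open>a\<close>; the former has square norm
\<open>(a - p) (a - b)\<close>. It can be used unless \<open>a = p\<close>, and then the matrix is already diagonal.\<close>

lemma sym2_diagonalize:
  fixes p q s :: "'a::field"
  assumes qc: "quadratically_closed TYPE('a)" and two: "(2::'a) \<noteq> 0"
    and ab: "a \<noteq> b" "p + s = a + b" "p * s - q * q = a * b"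
  shows "peels 2 0 (sym2 p q s) (diag_list [a, b])"
proof (cases "a = p")
  case True
  then have "s = b" using ab by simp
  then have "sym2 p q s = diag_list [a, b]" using True ab by (simp add: diag_list_pair)
  then show ?thesis using peels_refl[OF sym2_sym[of p q s]] by simp
next
  case False
  let ?A = "sym2 p q s" and ?v = "vec 2 (\<lambda>i. if i = 0 then q else a - p)"
  have s: "s = a + b - p" using ab(2) by (simp add: algebra_simps)
  have q: "q * q = (a - s) * (a - p)" using ab(3) unfolding s by (simp add: algebra_simps)
  have "?v \<bullet> ?v = (a - p) * (a - b)"
    using q unfolding vec2_scalar_prod s by (simp add: algebra_simps)
  then have v: "?v \<in> carrier_vec (Suc 1)" "?v \<bullet> ?v \<noteq> 0"
    using False ab(1) by (simp_all add: numeral_2_eq_2)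
  have "?A *\<^sub>v ?v = vec 2 (\<lambda>i. if i = 0 then a * q else a * (a - p))"
    unfolding sym2_mult_vec q by (intro eq_vecI) (auto simp: algebra_simps)
  also have "\<dots> = a \<cdot>\<^sub>v ?v" by (intro eq_vecI) auto
  finally have e: "?A *\<^sub>v ?v = a \<cdot>\<^sub>v ?v" .
  have A: "?A \<in> sym_mats (Suc 1)" using sym2_sym by (simp add: numeral_2_eq_2)
  obtain P B where P: "P \<in> orth (Suc 1)" "B \<in> sym_mats 1" "?A = conjugate_by P (direct_sum (diag_list [a]) B)"
    by (rule eigenvector_direct_sum[OF qc two A v e])
  obtain c where c: "B = diag_list [c]" by (rule singleton_diag_list[OF P(2)])
  have AP: "?A = conjugate_by P (diag_list [a, c])" using P(3) diag_list_append[of "[a]" "[c]"] by (simp add: c)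
  have P2: "P \<in> orth 2" using P(1) by (simp add: numeral_2_eq_2)
  have "mat_trace ?A = mat_trace (diag_list [a, c])"
    unfolding AP using diag_list_carrier[of "[a, c]"] by (intro mat_trace_conjugate_by[OF P2]) (simp add: numeral_2_eq_2)
  then have "c = b" using ab(2) by (simp add: diag_list_pair mat_trace_sym2)
  then show ?thesis using P2 AP sym2_sym[of a 0 b] by (auto simp: diag_list_pair peels.simps)
qed

text \<open>By the rule for trace and determinant in \<open>peels_sym2\<close>, two steps with intermediate trace \<open>y\<close> reach the
trace \<open>a + b\<close> and the determinant \<open>a b\<close> if \<open>y\<close> solves a quadratic equation. Trace and determinant
determine a symmetric matrix with distinct eigenvalues up to orthogonal conjugation. The
second step requires that the intermediate matrix is neither scalar nor nilpotent. A traceless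
intermediate matrix has determinant \<open>- (l - m)\<^sup>2 \<noteq> 0\<close>, so it is not nilpotent. It is scalar only if
\<open>l m = 0\<close> and \<open>y = 2 (l + m)\<close>, and then the other root of the quadratic is used.\<close>

lemma pair_peels:
  fixes l m :: "'a::field"
  assumes qc: "quadratically_closed TYPE('a)" and two: "(2::'a) \<noteq> 0"
    and lm: "l \<noteq> m" and ab: "a \<noteq> b"
  shows "peels 2 2 (diag_list [l, m]) (diag_list [a, b])"
proof -
  define t where "t = l + m"
  obtain c where c: "c * c = 0 * 0 - l * m" "\<And>d. peels 2 1 (sym2 l 0 m) (sym2 d (2 * c) (l + m))"
    using peels_sym2[OF qc two, of l m 0] lm
    by (metis add_0 add_eq_0_iff mult_zero_left mult_eq_0_iff neg_equal_0_iff_equal)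
  define t2 where "t2 = a + b"
  \<comment> \<open>The determinant after two steps is \<open>(t2 - y) y\<close> minus the square of the final off-diagonal entry;
     equating it to \<open>a b\<close> gives \<open>g y = 0\<close>.\<close>
  define g where "g y = y * y - (t2 + 4 * t) * y + (4 * t * t - 16 * (l * m) + a * b)" for y
  have "\<exists>y. g y = 0 \<and> (l * m = 0 \<longrightarrow> y \<noteq> 2 * t)"
  proof -
    obtain y where "y * y + (- (t2 + 4 * t)) * y + (4 * t * t - 16 * (l * m) + a * b) = 0"
      using quadratically_closed_root[OF qc] by blast
    then have y: "g y = 0" unfolding g_def by (simp add: algebra_simps)
    show ?thesis
    proof (cases "l * m = 0 \<and> y = 2 * t")
      case False
      then show ?thesis using y by auto
    next
      case True
      \<comment> \<open>\<open>t2 + 4 t - y\<close> is the other root; if both equal \<open>2 t\<close>, then \<open>a + b = 0\<close> and \<open>a b = 0\<close>.\<close>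
      have "g (t2 + 4 * t - y) = g y" by (simp add: g_def algebra_simps)
      moreover have "t2 + 4 * t - y \<noteq> 2 * t"
      proof
        assume "t2 + 4 * t - y = 2 * t"
        then have t2: "t2 = 0" using True by (simp add: algebra_simps)
        have "a * b = 0" using y True t2 by (simp add: g_def algebra_simps)
        then show False using t2 ab by (auto simp: t2_def)
      qed
      ultimately show ?thesis using y by metis
    qed
  qed
  then obtain y where y: "g y = 0" "l * m = 0 \<longrightarrow> y \<noteq> 2 * t" by blast
  have 1: "peels 2 1 (diag_list [l, m]) (sym2 (y - t) (2 * c) t)"
    using c(2) by (simp add: diag_list_pair t_def)
  have ns1: "\<not> (y - t = t \<and> 2 * c = 0)"
  proof
    assume *: "y - t = t \<and> 2 * c = 0"
    then have "c = 0" using two by simp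
    then have "l * m = 0" using c(1) by simp
    moreover have "y = 2 * t" using * by (simp add: algebra_simps)
    ultimately show False using y(2) by simp
  qed
  have ns2: "\<not> (y - t + t = 0 \<and> (2 * c) * (2 * c) = (y - t) * t)"
  proof
    assume *: "y - t + t = 0 \<and> (2 * c) * (2 * c) = (y - t) * t"
    then have "y = 0" by simp
    moreover have "(2 * c) * (2 * c) = 4 * (c * c)" by simp
    ultimately have "- 4 * (l * m) = - t * t" using * c(1) by simp
    then have "(l - m) * (l - m) = 0" by (simp add: t_def algebra_simps)
    then show False using lm by simp
  qed
  obtain c' where c': "c' * c' = (2 * c) * (2 * c) - (y - t) * t"
    "\<And>d. peels 2 1 (sym2 (y - t) (2 * c) t) (sym2 d (2 * c') (y - t + t))"
    using peels_sym2[OF qc two ns1 ns2] by blast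
  have 2: "peels 2 1 (sym2 (y - t) (2 * c) t) (sym2 (t2 - y) (2 * c') y)"
    using c'(2)[of "t2 - y"] by simp
  have 3: "peels 2 0 (sym2 (t2 - y) (2 * c') y) (diag_list [a, b])"
  proof (rule sym2_diagonalize[OF qc two ab])
    show "t2 - y + y = a + b" by (simp add: t2_def)
    have "(2 * c') * (2 * c') = 4 * (c' * c')" by simp
    also have "\<dots> = 4 * (4 * (c * c) - (y - t) * t)" unfolding c'(1) by simp
    also have "\<dots> = - 16 * (l * m) - 4 * (y - t) * t" using c(1) by (simp add: algebra_simps)
    finally have e: "(2 * c') * (2 * c') = - 16 * (l * m) - 4 * (y - t) * t" .
    have "(t2 - y) * y - (2 * c') * (2 * c') = a * b - g y"
      unfolding e by (simp add: g_def algebra_simps)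
    then show "(t2 - y) * y - (2 * c') * (2 * c') = a * b" using y(1) by simp
  qed
  show ?thesis using peels_trans[OF peels_trans[OF 1 2] 3] by (simp add: numeral_2_eq_2)
qed

section \<open>Diagonal matrices\<close>

definition list_peels :: "nat \<Rightarrow> 'a::field list \<Rightarrow> 'a list \<Rightarrow> bool" where
  "list_peels k xs ys \<longleftrightarrow> length ys = length xs \<and> peels (length xs) k (diag_list xs) (diag_list ys)"

lemma list_peels_trans: "list_peels j xs ys \<Longrightarrow> list_peels k ys zs \<Longrightarrow> list_peels (j + k) xs zs"
  by (auto simp: list_peels_def intro: peels_trans)

lemma list_peels_append: "list_peels k xs ys \<Longrightarrow> list_peels k xs' ys' \<Longrightarrow> list_peels k (xs @ xs') (ys @ ys')"
  by (auto simp: list_peels_def diag_list_append intro: peels_direct_sum)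

context
  assumes qc: "quadratically_closed TYPE('a::field)" and two: "(2::'a) \<noteq> 0"
begin

lemma list_peels_mono: "list_peels j (xs :: 'a list) ys \<Longrightarrow> j \<le> k \<Longrightarrow> list_peels k xs ys"
  by (auto simp: list_peels_def intro: peels_mono[OF two])

lemma list_peels_refl: "list_peels k (xs :: 'a list) xs"
  by (rule list_peels_mono[of 0]) (auto simp: list_peels_def peels_refl[OF diag_list_sym])

lemma list_peels_swap: "list_peels 0 [a, b :: 'a] [b, a]"
proof (cases "a = b")
  case False
  then show ?thesis using sym2_diagonalize[OF qc two, of b a a b 0]
    by (simp add: list_peels_def diag_list_pair[of a b] numeral_2_eq_2 mult.commute add.commute)
qed (simp add: list_peels_refl)

text \<open>Permutations of the eigenvalues cost no step: an adjacent transposition is a conjugation in a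
plane, and such conjugations generate all permutations.\<close>

lemma list_peels_to_front: "list_peels 0 (us @ x # vs :: 'a list) (x # us @ vs)"
proof (induction us)
  case (Cons u us)
  have "list_peels 0 ([u] @ (us @ x # vs)) ([u] @ (x # us @ vs))"
    by (intro list_peels_append list_peels_refl Cons)
  moreover have "list_peels 0 ([u, x] @ (us @ vs)) ([x, u] @ (us @ vs))"
    by (intro list_peels_append list_peels_refl list_peels_swap)
  ultimately show ?case using list_peels_trans[of 0 "u # us @ x # vs" "u # x # us @ vs" 0 "x # u # us @ vs"] by simp
qed (simp add: list_peels_refl)

lemma list_peels_perm_0: "mset (xs :: 'a list) = mset ys \<Longrightarrow> list_peels 0 ys xs"
proof (induction xs arbitrary: ys)
  case (Cons x xs)
  then have "x \<in> set ys" by (metis list.set_intros(1) set_mset_mset)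
  then obtain us vs where ys: "ys = us @ x # vs" by (meson split_list)
  then have "list_peels 0 (us @ vs) xs" using Cons by auto
  then have "list_peels 0 ([x] @ (us @ vs)) ([x] @ xs)" by (intro list_peels_append list_peels_refl)
  then show ?case using list_peels_trans[OF list_peels_to_front[of us x vs]] ys by fastforce
qed (simp add: list_peels_refl)

lemma list_peels_perm:
  assumes "mset xs = mset (xs' :: 'a list)" "list_peels k xs' ys"
  shows "list_peels k xs ys"
  using list_peels_trans[OF list_peels_perm_0[OF assms(1)[symmetric]] assms(2)] by simp

lemma list_peels_pair: "l \<noteq> m \<Longrightarrow> list_peels 2 [l, m :: 'a] [0, 1]"
  using pair_peels[OF qc two, of l m 0 1] by (simp add: list_peels_def numeral_2_eq_2)

lemma list_peels_pairs:
  "\<forall>(u, v) \<in> set ps. u \<noteq> (v :: 'a) \<Longrightarrow>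
    \<exists>hs. set hs \<subseteq> {0, 1} \<and> list_peels 2 (concat (map (\<lambda>(u, v). [u, v]) ps)) hs"
proof (induction ps)
  case (Cons p ps)
  obtain u v where p: "p = (u, v)" by force
  obtain hs where hs: "set hs \<subseteq> {0, 1}" "list_peels 2 (concat (map (\<lambda>(u, v). [u, v]) ps)) hs"
    using Cons by auto
  have "list_peels 2 ([u, v] @ concat (map (\<lambda>(u, v). [u, v]) ps)) ([0, 1] @ hs)"
    using Cons.prems p by (intro list_peels_append list_peels_pair hs) auto
  then show ?case using hs(1) p by (intro exI[of _ "[0, 1] @ hs"]) auto
qed (auto intro: list_peels_refl exI[of _ "[]"])

text \<open>As many copies of \<open>l\<close> as possible are paired with one zero or one each, and every such pair becomes
\<open>0, 1\<close>.\<close>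

lemma doubling_step:
  "set gs \<subseteq> {0, 1} \<Longrightarrow> l \<notin> {0, 1 :: 'a} \<Longrightarrow>
    \<exists>hs. set hs \<subseteq> {0, 1} \<and> list_peels 2 (gs @ replicate b l) (hs @ replicate (b - length gs) l)"
proof (induction gs arbitrary: b)
  case Nil
  then show ?case by (intro exI[of _ "[]"]) (auto intro: list_peels_refl)
next
  case (Cons g gs)
  show ?case
  proof (cases b)
    case 0
    then show ?thesis using Cons.prems by (intro exI[of _ "g # gs"]) (auto intro: list_peels_refl)
  next
    case (Suc c)
    obtain hs where hs: "set hs \<subseteq> {0, 1}" "list_peels 2 (gs @ replicate c l) (hs @ replicate (c - length gs) l)"
      using Cons.IH[of c] Cons.prems by auto
    have "list_peels 2 ([g, l] @ (gs @ replicate c l)) ([0, 1] @ (hs @ replicate (c - length gs) l))"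
      using Cons.prems by (intro list_peels_append list_peels_pair hs) auto
    then have "list_peels 2 ((g # gs) @ replicate b l) ([0, 1] @ (hs @ replicate (c - length gs) l))"
      by (rule list_peels_perm[rotated]) (simp add: Suc)
    then show ?thesis using hs(1) Suc by (intro exI[of _ "[0, 1] @ hs"]) auto
  qed
qed

text \<open>Every double step either uses up all copies of \<open>l\<close> or doubles the number of zeros and ones.\<close>

lemma doubling:
  "gs \<noteq> [] \<Longrightarrow> set gs \<subseteq> {0, 1} \<Longrightarrow> l \<notin> {0, 1 :: 'a} \<Longrightarrow> length gs + b \<le> 2 ^ j * length gs \<Longrightarrow>
    \<exists>hs. set hs \<subseteq> {0, 1} \<and> list_peels (2 * j) (gs @ replicate b l) hs"
proof (induction j arbitrary: gs b)
  case 0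
  then show ?case by (intro exI[of _ gs]) (auto intro: list_peels_refl)
next
  case (Suc j)
  obtain hs where hs: "set hs \<subseteq> {0, 1}" "list_peels 2 (gs @ replicate b l) (hs @ replicate (b - length gs) l)"
    using doubling_step Suc.prems by blast
  then have len: "length hs + (b - length gs) = length gs + b" by (simp add: list_peels_def)
  have "hs \<noteq> []" using len Suc.prems(1) by (cases gs; cases hs) auto
  moreover have "length hs + (b - length gs) \<le> 2 ^ j * length hs"
  proof (cases "b \<le> length gs")
    case True
    then show ?thesis by simp
  next
    case False
    then have "length hs = 2 * length gs" using len by simp
    then show ?thesis using len Suc.prems(4) by (simp add: algebra_simps)
  qed
  ultimately obtain ks where "set ks \<subseteq> {0, 1}" "list_peels (2 * j) (hs @ replicate (b - length gs) l) ks"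
    using Suc.IH hs(1) Suc.prems(3) by blast
  then show ?case using list_peels_trans[OF hs(2)] by auto
qed

text \<open>Greedy pairing: among the eigenvalues outside \<open>{0, 1}\<close>, pair distinct ones until the unpaired ones
are all equal.\<close>

lemma pairing:
  "\<exists>ps gs b l. mset xs = mset (concat (map (\<lambda>(u, v). [u, v]) ps) @ gs @ replicate b (l :: 'a))
      \<and> (\<forall>(u, v) \<in> set ps. u \<noteq> v) \<and> set gs \<subseteq> {0, 1} \<and> l \<notin> {0, 1}"
proof (induction xs)
  case Nil
  have "(- 1 :: 'a) \<notin> {0, 1}" using two by (auto simp: neg_eq_iff_add_eq_0)
  then show ?case by (intro exI[of _ "[]"] exI[of _ 0] exI[of _ "-1"]) auto
next
  case (Cons x xs)
  then obtain ps gs b l where *: "mset xs = mset (concat (map (\<lambda>(u, v). [u, v]) ps) @ gs @ replicate b l)"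
    "\<forall>(u, v) \<in> set ps. u \<noteq> v" "set gs \<subseteq> {0, 1}" "l \<notin> {0, 1}" by blast
  consider "x \<in> {0, 1}" | "x \<notin> {0, 1}" "b = 0" | "x = l" | c where "x \<noteq> l" "b = Suc c" by (cases b) auto
  then show ?case
  proof cases
    case 1
    then show ?thesis using * by (intro exI[of _ ps] exI[of _ "x # gs"] exI[of _ b] exI[of _ l]) auto
  next
    case 2
    then show ?thesis using * by (intro exI[of _ ps] exI[of _ gs] exI[of _ 1] exI[of _ x]) auto
  next
    case 3
    then show ?thesis using * by (intro exI[of _ ps] exI[of _ gs] exI[of _ "Suc b"] exI[of _ l]) auto
  next
    case 4
    then show ?thesis using * by (intro exI[of _ "(x, l) # ps"] exI[of _ gs] exI[of _ c] exI[of _ l]) auto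
  qed
qed

text \<open>The pairs of \<open>pairing\<close> and the pairs of \<open>doubling_step\<close> are treated in the same double step. Either kind
of pair produces two entries in \<open>{0, 1}\<close>, and if there is no pair of either kind, then the list is constant or has
no entry outside \<open>{0, 1}\<close>.\<close>

lemma first_phase:
  assumes "\<nexists>c. set (xs :: 'a list) \<subseteq> {c}"
  obtains hs b l where "set hs \<subseteq> {0, 1}" "l \<notin> {0, 1 :: 'a}" "b = 0 \<or> 2 \<le> length hs"
    "list_peels 2 xs (hs @ replicate b l)"
proof -
  obtain ps gs b l where *: "mset xs = mset (concat (map (\<lambda>(u, v). [u, v]) ps) @ gs @ replicate b l)"
    "\<forall>(u, v) \<in> set ps. u \<noteq> v" "set gs \<subseteq> {0, 1}" "l \<notin> {0, 1 :: 'a}" using pairing by blast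
  obtain hs where hs: "set hs \<subseteq> {0, 1}" "list_peels 2 (concat (map (\<lambda>(u, v). [u, v]) ps)) hs"
    using list_peels_pairs[OF *(2)] by blast
  obtain ks where ks: "set ks \<subseteq> {0, 1}" "list_peels 2 (gs @ replicate b l) (ks @ replicate (b - length gs) l)"
    using doubling_step[OF *(3,4)] by blast
  have "list_peels 2 xs ((hs @ ks) @ replicate (b - length gs) l)"
    using list_peels_perm[OF *(1) list_peels_append[OF hs(2) ks(2)]] by simp
  moreover have "b - length gs = 0 \<or> 2 \<le> length (hs @ ks)"
  proof (cases ps)
    case Nil
    have "gs \<noteq> []"
    proof
      assume "gs = []"
      then have "mset xs = mset (replicate b l)" using * Nil by simp
      then have "set xs = set (replicate b l)" by (metis set_mset_mset)
      then show False using assms by auto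
    qed
    moreover have "length ks + (b - length gs) = length gs + b"
      using ks(2) by (simp add: list_peels_def)
    ultimately show ?thesis by (cases gs; cases ks) auto
  next
    case (Cons p ps')
    moreover have "length hs = length (concat (map (\<lambda>(u, v). [u, v]) ps))"
      using hs(2) by (simp add: list_peels_def)
    moreover obtain u v where "p = (u, v)" by force
    ultimately have "2 \<le> length hs" by simp
    then show ?thesis by simp
  qed
  moreover have "set (hs @ ks) \<subseteq> {0, 1}" using hs(1) ks(1) by simp
  ultimately show ?thesis using that[of "hs @ ks" l "b - length gs"] *(4) by blast
qed

lemma nonconstant_list_peels:
  assumes "\<nexists>c. set (xs :: 'a list) \<subseteq> {c}" "length xs \<le> 2 ^ Suc j"
  shows "\<exists>hs. set hs \<subseteq> {0, 1} \<and> list_peels (2 * Suc j) xs hs"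
proof -
  obtain hs b l where *: "set hs \<subseteq> {0, 1}" "l \<notin> {0, 1 :: 'a}" "b = 0 \<or> 2 \<le> length hs"
    "list_peels 2 xs (hs @ replicate b l)" by (rule first_phase[OF assms(1)])
  show ?thesis
  proof (cases "b = 0")
    case True
    then have "list_peels 2 xs hs" using *(4) by simp
    then have "list_peels (2 * Suc j) xs hs" by (rule list_peels_mono) simp
    then show ?thesis using *(1) by blast
  next
    case False
    then have h: "2 \<le> length hs" using * by simp
    have "length hs + b = length xs" using *(4) by (simp add: list_peels_def)
    also have "\<dots> \<le> 2 ^ j * 2" using assms by simp
    also have "\<dots> \<le> 2 ^ j * length hs" using h by (intro mult_le_mono) auto
    finally have le: "length hs + b \<le> 2 ^ j * length hs" .
    have "hs \<noteq> []" using h by auto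
    from doubling[OF this *(1,2) le]
    obtain ks where ks: "set ks \<subseteq> {0, 1}" "list_peels (2 * j) (hs @ replicate b l) ks" by blast
    have "list_peels (2 * Suc j) xs ks" using list_peels_trans[OF *(4) ks(2)] by simp
    then show ?thesis using ks(1) by blast
  qed
qed

lemma diag_list_idempotent:
  assumes "set (xs :: 'a list) \<subseteq> {0, 1}"
  shows "diag_list xs \<in> sym_idempotents (length xs)"
proof -
  have "xs ! i * xs ! i = xs ! i" if "i < length xs" for i
    using assms nth_mem[OF that] by auto
  then have "diag_list xs * diag_list xs = diag_list xs"
    by (auto simp: diag_list_def) (auto simp: mat_diag_def)
  then show ?thesis
    using jordan_mult_self[OF two diag_list_carrier[of xs]] diag_list_sym by (simp add: idempotents_def)
qed

lemma nonconstant_idem_word: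
  assumes "\<nexists>c. set (xs :: 'a list) \<subseteq> {c}" "length xs \<le> 2 ^ Suc j"
    and "peels (length xs) k A (diag_list xs)"
  shows "idem_word_value (sym_mats (length xs)) jordan_mult (k + 2 * Suc j + 1) A"
proof -
  obtain hs where "set hs \<subseteq> {0, 1}" "list_peels (2 * Suc j) xs hs"
    using nonconstant_list_peels[OF assms(1,2)] by blast
  then have "diag_list hs \<in> sym_idempotents (length xs)"
    and "peels (length xs) (2 * Suc j) (diag_list xs) (diag_list hs)"
    using diag_list_idempotent[of hs] unfolding list_peels_def by metis+
  then show ?thesis using peels_idempotent[OF peels_trans[OF assms(3)]] by blast
qed

end

lemma diag_list_scalar: "set xs \<subseteq> {c} \<Longrightarrow> diag_list xs \<in> scalar_mats (length xs)"
proof -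
  assume "set xs \<subseteq> {c}"
  then have "xs ! i = c" if "i < length xs" for i using nth_mem[OF that] by auto
  then have "diag_list xs = c \<cdot>\<^sub>m 1\<^sub>m (length xs)"
    by (intro eq_matI) (auto simp: diag_list_def mat_diag_def)
  then show ?thesis by (auto simp: scalar_mats_def)
qed

section \<open>Polynomial functions\<close>

text \<open>Genericity is expressed by polynomial functions of one parameter \<open>s\<close>, normalised so that their values at
\<open>s = 0\<close> are visibly nonzero. This avoids any computation of degrees or leading coefficients.\<close>

definition polyfun :: "('a::field \<Rightarrow> 'a) \<Rightarrow> bool" where
  "polyfun f \<longleftrightarrow> (\<exists>p. \<forall>s. f s = poly p s)"

lemma polyfun_const: "polyfun (\<lambda>_. c)"
  unfolding polyfun_def by (intro exI[of _ "[:c:]"]) simp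

lemma polyfun_ident: "polyfun (\<lambda>s. s)"
  unfolding polyfun_def by (intro exI[of _ "[:0, 1:]"]) simp

lemma polyfun_add: "polyfun f \<Longrightarrow> polyfun g \<Longrightarrow> polyfun (\<lambda>s. f s + g s)"
  unfolding polyfun_def by (metis poly_add)

lemma polyfun_mult: "polyfun f \<Longrightarrow> polyfun g \<Longrightarrow> polyfun (\<lambda>s. f s * g s)"
  unfolding polyfun_def by (metis poly_mult)

lemma polyfun_diff: "polyfun f \<Longrightarrow> polyfun g \<Longrightarrow> polyfun (\<lambda>s. f s - g s)"
  unfolding polyfun_def by (metis poly_diff)

lemma polyfun_sum: "(\<And>i. i \<in> I \<Longrightarrow> polyfun (f i)) \<Longrightarrow> polyfun (\<lambda>s. \<Sum>i\<in>I. f i s)"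
  by (induction I rule: infinite_finite_induct) (auto intro: polyfun_const polyfun_add)

lemma polyfun_prod: "(\<And>i. i \<in> I \<Longrightarrow> polyfun (f i)) \<Longrightarrow> polyfun (\<lambda>s. \<Prod>i\<in>I. f i s)"
  by (induction I rule: infinite_finite_induct) (auto intro: polyfun_const polyfun_mult)

lemmas polyfun_intros = polyfun_const polyfun_ident polyfun_add polyfun_mult polyfun_diff polyfun_sum polyfun_prod

lemma polyfun_zeros_finite:
  assumes "polyfun f" "f 0 \<noteq> 0"
  shows "finite {s. f s = 0}"
proof -
  obtain p where p: "\<And>s. f s = poly p s" using assms(1) by (auto simp: polyfun_def)
  then have "p \<noteq> 0" using assms(2) by auto
  then show ?thesis unfolding p by (rule poly_roots_finite)
qed

lemma polyfun_det:
  assumes "\<And>s. M s \<in> carrier_mat n n" "\<And>i j. i < n \<Longrightarrow> j < n \<Longrightarrow> polyfun (\<lambda>s. M s $$ (i, j))"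
  shows "polyfun (\<lambda>s. det (M s))"
  unfolding det_def'[OF assms(1)]
  by (intro polyfun_intros assms(2)) (auto dest: permutes_in_image)

lemma polyfun_adj_mat:
  assumes "\<And>s. M s \<in> carrier_mat n n" "\<And>i j. i < n \<Longrightarrow> j < n \<Longrightarrow> polyfun (\<lambda>s. M s $$ (i, j))"
    and "i < n" "j < n"
  shows "polyfun (\<lambda>s. adj_mat (M s) $$ (i, j))"
proof -
  have dim: "dim_row (M s) = n" "dim_col (M s) = n" for s using assms(1)[of s] by auto
  have "adj_mat (M s) $$ (i, j) = (-1) ^ (j + i) * det (mat_delete (M s) j i)" for s
    using assms(3,4) dim by (simp add: adj_mat_def cofactor_def)
  moreover have "polyfun (\<lambda>s. det (mat_delete (M s) j i))"
  proof (rule polyfun_det)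
    show "mat_delete (M s) j i \<in> carrier_mat (n - 1) (n - 1)" for s
      using dim by (auto intro: carrier_matI)
    fix i' j' assume "i' < n - 1" "j' < n - 1"
    then show "polyfun (\<lambda>s. mat_delete (M s) j i $$ (i', j'))"
      using dim assms(3,4) by (simp add: mat_delete_def assms(2))
  qed
  ultimately show ?thesis by (simp add: polyfun_intros)
qed

lemma quadratically_closed_infinite:
  assumes qc: "quadratically_closed TYPE('a::field)" and two: "(2::'a) \<noteq> 0"
  shows "infinite (UNIV :: 'a set)"
proof
  assume fin: "finite (UNIV :: 'a set)"
  have "surj (\<lambda>x::'a. x * x)"
    using quadratically_closed_square_root[OF qc] by (metis surjI)
  then have "inj (\<lambda>x::'a. x * x)" by (rule finite_UNIV_surj_inj[OF fin])
  then have "(1::'a) = - 1" by (rule injD) simp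
  then have "(1::'a) + 1 = 0" by (rule eq_neg_iff_add_eq_0[THEN iffD1])
  then show False using two by simp
qed

section \<open>Splitting off an eigenvector\<close>

lemma scalar_mats_index:
  assumes "A \<in> scalar_mats n" "i < n" "j < n"
  shows "A $$ (i, j) = (if i = j then A $$ (0, 0) else 0)"
  using assms by (auto simp: scalar_mats_def)

text \<open>For \<open>c\<close> outside the spectrum of \<open>a\<close> the equation determines \<open>w = 2 (c - a)\<inverse> b\<close>. With
\<open>c = 1 / s\<close> and Cramer's rule, \<open>w = (2 s / det (1 - s a)) adj (1 - s a) b\<close>. After clearing the denominator \<open>det (1 - s a)\<close>,
each of the required inequations says that a polynomial in \<open>s\<close> does not vanish, and at \<open>s = 0\<close> none
of them does. As the field is infinite, some \<open>s \<noteq> 0\<close> satisfies all of them.\<close>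

lemma generic_parameter:
  fixes a :: "'a::field mat"
  assumes qc: "quadratically_closed TYPE('a)" and two: "(2::'a) \<noteq> 0"
    and a: "a \<in> carrier_mat m m" and b: "b \<in> carrier_vec m" and t: "t \<noteq> 0"
  obtains c w where "w \<in> carrier_vec m" "2 \<cdot>\<^sub>v b + a *\<^sub>v w = c \<cdot>\<^sub>v w" "1 + w \<bullet> w \<noteq> 0"
    "t - 2 * (b \<bullet> w) \<noteq> 0" "c \<noteq> e"
proof -
  define M where "M s = 1\<^sub>m m - s \<cdot>\<^sub>m a" for s
  define D where "D s = det (M s)" for s
  define W where "W s = adj_mat (M s) *\<^sub>v b" for s
  have M: "M s \<in> carrier_mat m m" for s
    using a by (simp add: M_def minus_carrier_mat)
  have Wc: "W s \<in> carrier_vec m" for s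
    unfolding W_def by (rule mult_mat_vec_carrier[OF adj_mat(1)[OF M] b])
  have Mp: "polyfun (\<lambda>s. M s $$ (i, j))" if "i < m" "j < m" for i j
    using that a by (simp add: M_def polyfun_intros)
  have Dp: "polyfun D" unfolding D_def by (rule polyfun_det[OF M Mp])
  have W_index: "W s $ i = (\<Sum>j = 0..<m. adj_mat (M s) $$ (i, j) * b $ j)" if "i < m" for s i
    using that b adj_mat(1)[OF M, of s] by (simp add: W_def scalar_prod_def)
  have Wp: "polyfun (\<lambda>s. W s $ i)" if "i < m" for i
    unfolding W_index[OF that] by (intro polyfun_intros polyfun_adj_mat[OF M Mp] that) simp_all
  have "polyfun (\<lambda>s. \<Sum>i = 0..<m. W s $ i * W s $ i)" by (intro polyfun_intros Wp) simp_all
  moreover have "W s \<bullet> W s = (\<Sum>i = 0..<m. W s $ i * W s $ i)" for s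
    using Wc[of s] by (simp add: scalar_prod_def)
  ultimately have WWp: "polyfun (\<lambda>s. W s \<bullet> W s)" by simp
  have "polyfun (\<lambda>s. \<Sum>i = 0..<m. b $ i * W s $ i)" by (intro polyfun_intros Wp) simp_all
  moreover have "b \<bullet> W s = (\<Sum>i = 0..<m. b $ i * W s $ i)" for s
    using Wc[of s] by (simp add: scalar_prod_def)
  ultimately have bWp: "polyfun (\<lambda>s. b \<bullet> W s)" by simp
  define N where "N s = D s * D s + 4 * s * s * (W s \<bullet> W s)" for s
  define T where "T s = t * D s - 4 * s * (b \<bullet> W s)" for s
  define E where "E s = 1 - s * e" for s
  have Np: "polyfun N" and Tp: "polyfun T" and Ep: "polyfun E"
    unfolding N_def T_def E_def by (intro polyfun_intros Dp WWp bWp)+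
  have "M 0 = 1\<^sub>m m" using a by (intro eq_matI) (auto simp: M_def)
  then have D0: "D 0 = 1" by (simp add: D_def)
  \<comment> \<open>\<open>N\<close> and \<open>T\<close> are \<open>1 + w \<bullet> w\<close> and \<open>t - 2 (b \<bullet> w)\<close> multiplied by \<open>D\<^sup>2\<close> and \<open>D\<close>; \<open>E\<close> excludes \<open>1 / s = e\<close>.\<close>
  have nz: "D 0 \<noteq> 0" "N 0 \<noteq> 0" "T 0 \<noteq> 0" "E 0 \<noteq> 0"
    using t by (simp_all add: D0 N_def T_def E_def)
  have fin: "finite ({s. D s = 0} \<union> {s. N s = 0} \<union> {s. T s = 0} \<union> {s. E s = 0} \<union> {0})"
    using polyfun_zeros_finite[OF Dp] polyfun_zeros_finite[OF Np] polyfun_zeros_finite[OF Tp]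
      polyfun_zeros_finite[OF Ep] nz by simp
  obtain s where "s \<notin> {s. D s = 0} \<union> {s. N s = 0} \<union> {s. T s = 0} \<union> {s. E s = 0} \<union> {0}"
    by (rule exE[OF ex_new_if_finite[OF quadratically_closed_infinite[OF qc two] fin]])
  then have s: "D s \<noteq> 0" "N s \<noteq> 0" "T s \<noteq> 0" "E s \<noteq> 0" "s \<noteq> 0" by auto
  define k where "k = 2 * s / D s"
  have kD: "k * D s = 2 * s" using s by (simp add: k_def)
  define w where "w = k \<cdot>\<^sub>v W s"
  have w: "w \<in> carrier_vec m" using Wc by (simp add: w_def)
  have "M s *\<^sub>v W s = (M s * adj_mat (M s)) *\<^sub>v b"
    unfolding W_def by (rule assoc_mult_mat_vec[OF M adj_mat(1)[OF M] b, symmetric])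
  also have "\<dots> = D s \<cdot>\<^sub>v b"
    unfolding adj_mat(2)[OF M] D_def[symmetric] using b by (intro eq_vecI) simp_all
  finally have "M s *\<^sub>v w = (2 * s) \<cdot>\<^sub>v b"
    unfolding w_def mult_mat_vec[OF M Wc] by (simp add: smult_smult_assoc kD)
  moreover have "M s *\<^sub>v w = 1\<^sub>m m *\<^sub>v w - (s \<cdot>\<^sub>m a) *\<^sub>v w"
    unfolding M_def using a by (intro minus_mult_distrib_mat_vec[where nr = m, OF _ _ w]) simp_all
  moreover have "(s \<cdot>\<^sub>m a) *\<^sub>v w = s \<cdot>\<^sub>v (a *\<^sub>v w)"
    using a w by (intro eq_vecI) simp_all
  ultimately have eq: "w - s \<cdot>\<^sub>v (a *\<^sub>v w) = (2 * s) \<cdot>\<^sub>v b"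
    using one_mult_mat_vec[OF w] by metis
  have 1: "2 \<cdot>\<^sub>v b + a *\<^sub>v w = (1 / s) \<cdot>\<^sub>v w"
  proof (rule eq_vecI)
    fix i assume "i < dim_vec ((1 / s) \<cdot>\<^sub>v w)"
    then have i: "i < m" using w by simp
    have "(w - s \<cdot>\<^sub>v (a *\<^sub>v w)) $ i = ((2 * s) \<cdot>\<^sub>v b) $ i" unfolding eq ..
    then have "w $ i = s * (2 * b $ i + (a *\<^sub>v w) $ i)"
      using i a b w by (simp add: algebra_simps del: index_mult_mat_vec)
    then show "(2 \<cdot>\<^sub>v b + a *\<^sub>v w) $ i = ((1 / s) \<cdot>\<^sub>v w) $ i"
      using i a b w s by (simp del: index_mult_mat_vec)
  qed (use a b w in auto)
  have "(1 + w \<bullet> w) * (D s * D s) = D s * D s + (k * D s) * (k * D s) * (W s \<bullet> W s)"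
    using Wc[of s] by (simp add: w_def algebra_simps)
  also have "\<dots> = N s" unfolding kD by (simp add: N_def)
  finally have 2: "1 + w \<bullet> w \<noteq> 0" using s by auto
  have "(t - 2 * (b \<bullet> w)) * D s = t * D s - 2 * (k * D s) * (b \<bullet> W s)"
    using Wc[of s] b by (simp add: w_def algebra_simps)
  also have "\<dots> = T s" unfolding kD by (simp add: T_def)
  finally have 3: "t - 2 * (b \<bullet> w) \<noteq> 0" using s by auto
  have 4: "1 / s \<noteq> e" using s by (auto simp: E_def)
  show ?thesis by (rule that[OF w 1 2 3 4])
qed

text \<open>After the step the matrix is \<open>X = bordered d (2 b) a\<close> with \<open>d\<close> free. The vector \<open>(1, w)\<close> is an eigenvector
for \<open>c\<close> if \<open>2 b + a w = c w\<close> and \<open>d = c - 2 b \<bullet> w\<close>; so \<open>w\<close> and \<open>c\<close> are taken from \<open>generic_parameter\<close>, whose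
inequations make the eigenvector nonisotropic, the trace \<open>tr A - 2 b \<bullet> w\<close> of the complementary block
nonzero, and \<open>X\<close> nonscalar. The trace condition on \<open>B\<close> keeps the induction alive down to
size two, where traceless matrices may be nilpotent.\<close>

lemma isotropic_reduction:
  fixes A :: "'a::field mat"
  assumes qc: "quadratically_closed TYPE('a)" and two: "(2::'a) \<noteq> 0"
    and A: "A \<in> sym_mats (Suc m)" "mat_trace A \<noteq> 0" and m: "0 < m"
    and v: "v \<in> carrier_vec (Suc m)" "v \<bullet> v \<noteq> 0" "v \<bullet> (A *\<^sub>v v) = 0"
  obtains c B where "B \<in> sym_mats m" "mat_trace B \<noteq> 0" "peels (Suc m) 1 A (direct_sum (diag_list [c]) B)"
    "direct_sum (diag_list [c]) B \<notin> scalar_mats (Suc m)"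
proof -
  obtain P b a where P: "P \<in> orth (Suc m)" "b \<in> carrier_vec m" "a \<in> sym_mats m" "A = conjugate_by P (bordered 0 b a)"
    by (rule isotropic_vector_bordered[OF qc two A(1) v])
  have ac: "a \<in> carrier_mat m m" using P(3) by (rule sym_mats_carrier)
  have bc: "bordered d b' a \<in> carrier_mat (Suc m) (Suc m)" for d b'
    using bordered_sym[OF P(3)] sym_mats_carrier by blast
  have trA: "mat_trace A = mat_trace a" unfolding P(4) using mat_trace_conjugate_by[OF P(1) bc] by (simp add: mat_trace_bordered)
  obtain c w where w: "w \<in> carrier_vec m" "2 \<cdot>\<^sub>v b + a *\<^sub>v w = c \<cdot>\<^sub>v w" "1 + w \<bullet> w \<noteq> 0"
    "mat_trace a - 2 * (b \<bullet> w) \<noteq> 0" "c \<noteq> a $$ (0, 0)"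
    using generic_parameter[OF qc two ac P(2), of "mat_trace a" "a $$ (0, 0)"] A(2) trA by metis
  define d where "d = c - 2 * (b \<bullet> w)"
  let ?X = "bordered d (2 \<cdot>\<^sub>v b) a"
  have peel: "peels (Suc m) 1 A ?X"
    unfolding P(4) by (rule peels_conjugate_by[OF peels_bordered[OF two P(3,2)] P(1)])
  have X: "?X \<in> sym_mats (Suc m)" using P(3) by (rule bordered_sym)
  have ns: "?X \<notin> scalar_mats (Suc m)"
  proof
    assume s: "?X \<in> scalar_mats (Suc m)"
    have "b $ i = 0" if "i < m" for i
      using scalar_mats_index[OF s, of 0 "Suc i"] that ac P(2) two by simp
    then have "b = 0\<^sub>v m" using P(2) by (intro eq_vecI) auto
    then have "d = c" using w(1) by (simp add: d_def)
    moreover have "d = a $$ (0, 0)"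
      using scalar_mats_index[OF s, of 1 1] m ac by simp
    ultimately show False using w(5) by simp
  qed
  let ?u = "vCons 1 w"
  have "?X *\<^sub>v ?u = vCons (d * 1 + (2 \<cdot>\<^sub>v b) \<bullet> w) (1 \<cdot>\<^sub>v (2 \<cdot>\<^sub>v b) + a *\<^sub>v w)"
    using P(2) w(1) by (intro bordered_mult_vec[OF ac]) auto
  also have "\<dots> = vCons c (c \<cdot>\<^sub>v w)"
    using P(2) w(1) by (simp add: w(2) d_def)
  also have "\<dots> = c \<cdot>\<^sub>v ?u"
    by (rule eq_vecI) (auto simp: vec_index_vCons)
  finally have eig: "?X *\<^sub>v ?u = c \<cdot>\<^sub>v ?u" .
  have u: "?u \<in> carrier_vec (Suc m)" "?u \<bullet> ?u \<noteq> 0" using w by simp_all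
  obtain Q B where Q: "Q \<in> orth (Suc m)" "B \<in> sym_mats m" "?X = conjugate_by Q (direct_sum (diag_list [c]) B)"
    by (rule eigenvector_direct_sum[OF qc two X u eig])
  let ?Y = "direct_sum (diag_list [c]) B"
  have Y: "?Y = bordered c (0\<^sub>v m) B"
    using bordered_zero_direct_sum[OF sym_mats_carrier[OF Q(2)]] by metis
  have Ys: "?Y \<in> sym_mats (Suc m)" unfolding Y using Q(2) by (rule bordered_sym)
  have "mat_trace ?X = mat_trace ?Y" unfolding Q(3) by (rule mat_trace_conjugate_by[OF Q(1) sym_mats_carrier[OF Ys]])
  then have "mat_trace B = mat_trace a - 2 * (b \<bullet> w)"
    unfolding Y mat_trace_bordered d_def by (simp add: algebra_simps)
  then have "mat_trace B \<noteq> 0" using w(4) by simp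
  moreover have "peels (Suc m) 0 ?X ?Y" using Q(1,3) Ys by (auto simp: peels.simps)
  then have "peels (Suc m) 1 A ?Y" using peels_trans[OF peel] by fastforce
  moreover have "?Y \<notin> scalar_mats (Suc m)"
    using ns conjugate_by_scalar_iff[OF Q(1) sym_mats_carrier[OF Ys]] Q(3) by metis
  ultimately show ?thesis using that Q(2) by blast
qed

section \<open>Isotropic vectors of nonscalar matrices\<close>

lemma sparse_forms:
  fixes A :: "'a::field mat"
  assumes A: "A \<in> carrier_mat n n" and S: "S \<subseteq> {0..<n}" and f: "\<forall>i. i \<notin> S \<longrightarrow> f i = 0"
  shows "vec n f \<bullet> (A *\<^sub>v vec n f) = (\<Sum>i\<in>S. f i * (\<Sum>j\<in>S. A $$ (i, j) * f j))"
    and "vec n f \<bullet> vec n f = (\<Sum>i\<in>S. f i * f i)"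
proof -
  have inner: "(\<Sum>j = 0..<n. A $$ (i, j) * f j) = (\<Sum>j\<in>S. A $$ (i, j) * f j)" for i
    using S f by (intro sum.mono_neutral_right) auto
  have "vec n f \<bullet> (A *\<^sub>v vec n f) = (\<Sum>i = 0..<n. f i * (\<Sum>j = 0..<n. A $$ (i, j) * f j))"
    using A by (simp add: scalar_prod_def)
  also have "\<dots> = (\<Sum>i\<in>S. f i * (\<Sum>j = 0..<n. A $$ (i, j) * f j))"
    using S f by (intro sum.mono_neutral_right) auto
  finally show "vec n f \<bullet> (A *\<^sub>v vec n f) = (\<Sum>i\<in>S. f i * (\<Sum>j\<in>S. A $$ (i, j) * f j))"
    by (simp only: inner)
  have "vec n f \<bullet> vec n f = (\<Sum>i = 0..<n. f i * f i)" by (simp add: scalar_prod_def)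
  also have "\<dots> = (\<Sum>i\<in>S. f i * f i)" using S f by (intro sum.mono_neutral_right) auto
  finally show "vec n f \<bullet> vec n f = (\<Sum>i\<in>S. f i * f i)" .
qed

lemma principal_minor_dichotomy:
  fixes A :: "'a::field mat"
  assumes qc: "quadratically_closed TYPE('a)" and two: "(2::'a) \<noteq> 0"
    and A: "A \<in> sym_mats n" and ij: "i < n" "j < n" "i \<noteq> j"
    and no: "\<forall>v \<in> carrier_vec n. v \<bullet> (A *\<^sub>v v) = 0 \<longrightarrow> v \<bullet> v = 0"
  shows "A $$ (i, i) = A $$ (j, j) \<and> A $$ (i, j) = 0
    \<or> A $$ (i, i) + A $$ (j, j) = 0 \<and> A $$ (i, j) * A $$ (i, j) = A $$ (i, i) * A $$ (j, j)"
proof (rule ccontr)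
  assume "\<not> ?thesis"
  then obtain x y where xy: "A $$ (i, i) * x * x + 2 * A $$ (i, j) * x * y + A $$ (j, j) * y * y = 0" "x * x + y * y \<noteq> 0"
    using binary_form_zero[OF qc two, of "A $$ (i, i)" "A $$ (j, j)" "A $$ (i, j)"] by blast
  define f where "f k = (if k = i then x else if k = j then y else 0)" for k
  have ji: "A $$ (j, i) = A $$ (i, j)" using sym_mats_index[OF A] ij by simp
  have S: "{i, j} \<subseteq> {0..<n}" "\<forall>k. k \<notin> {i, j} \<longrightarrow> f k = 0" using ij by (auto simp: f_def)
  note forms = sparse_forms[OF sym_mats_carrier[OF A] S]
  have pair: "(\<Sum>k\<in>{i, j}. g k) = g i + g j" for g :: "nat \<Rightarrow> 'a" using ij by simp
  have fi: "f i = x" and fj: "f j = y" using ij by (simp_all add: f_def)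
  have "vec n f \<bullet> (A *\<^sub>v vec n f) = A $$ (i, i) * x * x + 2 * A $$ (i, j) * x * y + A $$ (j, j) * y * y"
    unfolding forms(1) pair fi fj ji by (simp add: algebra_simps)
  then have "vec n f \<bullet> (A *\<^sub>v vec n f) = 0" using xy(1) by (rule trans)
  moreover have "vec n f \<bullet> vec n f \<noteq> 0"
    unfolding forms(2) pair fi fj by (rule xy(2))
  ultimately show False using no by simp
qed

text \<open>The vector is \<open>x e\<^sub>i - \<epsilon> x e\<^sub>j + e\<^sub>k\<close>, where \<open>\<epsilon>\<close> is the sign with \<open>A\<^sub>j\<^sub>k = \<epsilon> A\<^sub>i\<^sub>k\<close>: the two cross terms
cancel, and \<open>2 x\<^sup>2 = 1\<close> balances the diagonal terms. Its square norm is \<open>2 x\<^sup>2 + 1 = 2\<close>.\<close>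

lemma ternary_isotropic:
  fixes A :: "'a::field mat"
  assumes qc: "quadratically_closed TYPE('a)" and two: "(2::'a) \<noteq> 0"
    and A: "A \<in> sym_mats n" and ijk: "i < n" "j < n" "k < n" "i \<noteq> j" "j \<noteq> k" "i \<noteq> k"
    and diag: "A $$ (j, j) = A $$ (i, i)" "A $$ (k, k) = - A $$ (i, i)" "A $$ (i, j) = 0"
    and off: "A $$ (i, k) * A $$ (i, k) = A $$ (j, k) * A $$ (j, k)"
  shows "\<exists>v \<in> carrier_vec n. v \<bullet> (A *\<^sub>v v) = 0 \<and> v \<bullet> v \<noteq> 0"
proof -
  define p g h where "p = A $$ (i, i)" and "g = A $$ (i, k)" and "h = A $$ (j, k)"
  have "(h - g) * (h + g) = 0" using off by (simp add: g_def h_def algebra_simps)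
  then have "h = g \<or> h = - g" by (auto simp: eq_neg_iff_add_eq_0)
  then obtain \<epsilon> :: 'a where e: "h = \<epsilon> * g" "\<epsilon> * \<epsilon> = 1"
    by (metis mult_1 mult_minus1 minus_mult_minus)
  obtain x :: 'a where xx: "x * x = 1 / 2" using quadratically_closed_square_root[OF qc] by blast
  have x: "2 * (x * x) = 1" unfolding xx using two by simp
  define f where "f l = (if l = i then x else if l = j then - (\<epsilon> * x) else if l = k then 1 else 0)" for l
  have sym: "A $$ (j, i) = 0" "A $$ (k, i) = g" "A $$ (k, j) = h"
    using sym_mats_index[OF A] ijk diag(3) by (simp_all add: g_def h_def)
  have S: "{i, j, k} \<subseteq> {0..<n}" "\<forall>l. l \<notin> {i, j, k} \<longrightarrow> f l = 0" using ijk by (auto simp: f_def)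
  note forms = sparse_forms[OF sym_mats_carrier[OF A] S]
  have triple: "(\<Sum>l\<in>{i, j, k}. u l) = u i + u j + u k" for u :: "nat \<Rightarrow> 'a" using ijk by (simp add: add.assoc)
  have fs: "f i = x" "f j = - (\<epsilon> * x)" "f k = 1" using ijk by (auto simp: f_def)
  have "vec n f \<bullet> (A *\<^sub>v vec n f) = x * (p * x + 0 * - (\<epsilon> * x) + g * 1)
      + - (\<epsilon> * x) * (0 * x + p * - (\<epsilon> * x) + \<epsilon> * g * 1) + 1 * (g * x + \<epsilon> * g * - (\<epsilon> * x) + - p * 1)"
    unfolding forms(1) triple fs diag sym unfolding p_def[symmetric] g_def[symmetric] h_def[symmetric] e(1) ..
  also have "\<dots> = p * (x * x) + (\<epsilon> * \<epsilon>) * p * (x * x) - p + 2 * (x * g) - 2 * ((\<epsilon> * \<epsilon>) * (x * g))"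
    by (simp add: algebra_simps)
  also have "\<dots> = p * (2 * (x * x)) - p" unfolding e(2) by (simp add: algebra_simps)
  finally have 1: "vec n f \<bullet> (A *\<^sub>v vec n f) = 0" unfolding x by simp
  have "vec n f \<bullet> vec n f = x * x + (\<epsilon> * \<epsilon>) * (x * x) + 1"
    unfolding forms(2) triple fs by (simp add: algebra_simps)
  also have "\<dots> = 2 * (x * x) + 1" unfolding e(2) by simp
  finally have "vec n f \<bullet> vec n f = 2" unfolding x by simp
  with 1 two show ?thesis by (intro bexI[of _ "vec n f"]) auto
qed

text \<open>If every zero of the form is isotropic, then every principal minor of size two is scalar or
nilpotent. As \<open>A\<close> is nonscalar, some minor is nilpotent and not scalar, so the diagonal contains \<open>p\<close> and
\<open>- p\<close> with \<open>p \<noteq> 0\<close>. In size two the trace is then zero. In larger size a third index agrees with one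
of the two, which is the situation of \<open>ternary_isotropic\<close>.\<close>

lemma nonscalar_isotropic:
  fixes A :: "'a::field mat"
  assumes qc: "quadratically_closed TYPE('a)" and two: "(2::'a) \<noteq> 0"
    and A: "A \<in> sym_mats n" "A \<notin> scalar_mats n" and n: "3 \<le> n \<or> n = 2 \<and> mat_trace A \<noteq> 0"
  obtains v where "v \<in> carrier_vec n" "v \<bullet> v \<noteq> 0" "v \<bullet> (A *\<^sub>v v) = 0"
proof -
  have "\<exists>v \<in> carrier_vec n. v \<bullet> (A *\<^sub>v v) = 0 \<and> v \<bullet> v \<noteq> 0"
  proof (rule ccontr)
    assume none: "\<not> ?thesis"
    then have no: "\<forall>v \<in> carrier_vec n. v \<bullet> (A *\<^sub>v v) = 0 \<longrightarrow> v \<bullet> v = 0" by blast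
    note dich = principal_minor_dichotomy[OF qc two A(1) _ _ _ no]
    have "\<exists>i j. i < n \<and> j < n \<and> i \<noteq> j \<and> \<not> (A $$ (i, i) = A $$ (j, j) \<and> A $$ (i, j) = 0)"
    proof (rule ccontr)
      assume "\<not> ?thesis"
      then have *: "A $$ (i, i) = A $$ (j, j)" "A $$ (i, j) = 0" if "i < n" "j < n" "i \<noteq> j" for i j
        using that by blast+
      have "A = A $$ (0, 0) \<cdot>\<^sub>m 1\<^sub>m n"
      proof (rule eq_matI)
        fix i j assume "i < dim_row (A $$ (0, 0) \<cdot>\<^sub>m 1\<^sub>m n)" "j < dim_col (A $$ (0, 0) \<cdot>\<^sub>m 1\<^sub>m n)"
        then have ij: "i < n" "j < n" by auto
        have "A $$ (i, i) = A $$ (0, 0)" using *(1)[of i 0] ij by (cases "i = 0") auto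
        then show "A $$ (i, j) = (A $$ (0, 0) \<cdot>\<^sub>m 1\<^sub>m n) $$ (i, j)"
          using ij *(2)[of i j] by (cases "i = j") auto
      qed (use sym_mats_carrier[OF A(1)] in auto)
      then show False using A(2) by (auto simp: scalar_mats_def)
    qed
    then obtain i j where ij: "i < n" "j < n" "i \<noteq> j" and bad: "\<not> (A $$ (i, i) = A $$ (j, j) \<and> A $$ (i, j) = 0)"
      by blast
    define p where "p = A $$ (i, i)"
    have d2: "A $$ (i, i) + A $$ (j, j) = 0" "A $$ (i, j) * A $$ (i, j) = A $$ (i, i) * A $$ (j, j)"
      using dich[OF ij] bad by blast+
    then have j1: "A $$ (j, j) = - p" by (simp add: p_def eq_neg_iff_add_eq_0 add.commute)
    with d2(2) have j2: "A $$ (j, j) = - p" "A $$ (i, j) * A $$ (i, j) = - (p * p)" by (simp_all add: p_def)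
    have p: "p \<noteq> 0" using bad j2 by (auto simp: p_def)
    have pp: "p + p \<noteq> 0" using two p by (metis mult_2 mult_eq_0_iff)
    show False
    proof (cases "n = 2")
      case True
      then have "{i, j} = {0, 1}" using ij by auto
      then have "A $$ (0, 0) + A $$ (1, 1) = p + - p"
        using j2(1) ij(3) unfolding p_def by (auto simp: doubleton_eq_iff add.commute)
      then have "mat_trace A = 0"
        using True sym_mats_carrier[OF A(1)] by (simp add: mat_trace_def numeral_2_eq_2)
      then show False using n True by simp
    next
      case False
      then have "3 \<le> n" using n by simp
      then have "\<not> {0..<n} \<subseteq> {i, j}"
        using card_mono[of "{i, j}" "{0..<n}"] ij(3) by auto
      then obtain l where "l \<in> {0..<n}" "l \<notin> {i, j}" by blast
      then have l: "l \<noteq> i" "l \<noteq> j" "l < n" by auto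
      have sym: "A $$ (j, i) = A $$ (i, j)" "A $$ (l, j) = A $$ (j, l)" "A $$ (l, i) = A $$ (i, l)"
        using sym_mats_index[OF A(1)] l ij by simp_all
      show False
      proof (cases "A $$ (l, l) = p")
        case True
        have "A $$ (i, i) + A $$ (l, l) \<noteq> 0" using True pp by (simp add: p_def)
        then have il: "A $$ (i, l) = 0" using dich[of i l] ij(1) l by blast
        have "A $$ (j, j) \<noteq> A $$ (l, l)" unfolding j2 True using pp by (simp add: neg_eq_iff_add_eq_0)
        then have "A $$ (j, l) * A $$ (j, l) = A $$ (j, j) * A $$ (l, l)" using dich[of j l] ij(2) l by blast
        then have "A $$ (i, j) * A $$ (i, j) = A $$ (l, j) * A $$ (l, j)"
          unfolding sym j2 True by simp
        then have "\<exists>v \<in> carrier_vec n. v \<bullet> (A *\<^sub>v v) = 0 \<and> v \<bullet> v \<noteq> 0"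
          using ij l il True j1 unfolding p_def
          by (intro ternary_isotropic[OF qc two A(1), of i l j]) simp_all
        then show False using none by blast
      next
        case False
        then have d3: "A $$ (i, i) + A $$ (l, l) = 0" "A $$ (i, l) * A $$ (i, l) = A $$ (i, i) * A $$ (l, l)"
          using dich[of i l] ij(1) l unfolding p_def by metis+
        then have ll: "A $$ (l, l) = - p" by (simp add: p_def eq_neg_iff_add_eq_0 add.commute)
        have "A $$ (j, j) + A $$ (l, l) = - (p + p)" unfolding j1 ll by simp
        then have "A $$ (j, j) + A $$ (l, l) \<noteq> 0" using pp by simp
        then have jl: "A $$ (j, l) = 0" using dich[of j l] ij(2) l by blast
        have "A $$ (j, i) * A $$ (j, i) = A $$ (l, i) * A $$ (l, i)"
          unfolding sym j2 d3(2) ll p_def by simp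
        then have "\<exists>v \<in> carrier_vec n. v \<bullet> (A *\<^sub>v v) = 0 \<and> v \<bullet> v \<noteq> 0"
          using ij l jl j1 ll by (intro ternary_isotropic[OF qc two A(1), of j l i]) (simp_all add: p_def)
        then show False using none by blast
      qed
    qed
  qed
  then show ?thesis using that by blast
qed

section \<open>Reaching a diagonal matrix\<close>

lemma scalar_diag_list:
  assumes "B \<in> scalar_mats m"
  obtains k where "B = diag_list (replicate m k)"
proof -
  obtain k where "B = k \<cdot>\<^sub>m 1\<^sub>m m" using assms by (auto simp: scalar_mats_def)
  then have "B = diag_list (replicate m k)"
    by (intro eq_matI) (auto simp: diag_list_def mat_diag_def)
  then show ?thesis using that by blast
qed

text \<open>Each step splits off one eigenvalue. If the remaining block is scalar, the matrix is already diagonal.\<close>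

lemma peels_to_diagonal:
  fixes A :: "'a::field mat"
  assumes qc: "quadratically_closed TYPE('a)" and two: "(2::'a) \<noteq> 0"
  shows "A \<in> sym_mats m \<Longrightarrow> A \<notin> scalar_mats m \<Longrightarrow> mat_trace A \<noteq> 0 \<Longrightarrow>
    \<exists>xs. length xs = m \<and> peels m (m - 1) A (diag_list xs) \<and> diag_list xs \<notin> scalar_mats m"
proof (induction m arbitrary: A)
  case 0
  then have "A = 0 \<cdot>\<^sub>m 1\<^sub>m 0" using sym_mats_carrier[OF 0(1)] by (intro eq_matI) auto
  then show ?case using 0 by (auto simp: scalar_mats_def)
next
  case (Suc m)
  show ?case
  proof (cases "m = 0")
    case True
    then have "A = A $$ (0, 0) \<cdot>\<^sub>m 1\<^sub>m 1"
      using sym_mats_carrier[OF Suc.prems(1)] by (intro eq_matI) auto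
    then show ?thesis using Suc.prems True by (auto simp: scalar_mats_def)
  next
    case False
    then have "3 \<le> Suc m \<or> Suc m = 2 \<and> mat_trace A \<noteq> 0" using Suc.prems by auto
    then obtain v where v: "v \<in> carrier_vec (Suc m)" "v \<bullet> v \<noteq> 0" "v \<bullet> (A *\<^sub>v v) = 0"
      using nonscalar_isotropic[OF qc two Suc.prems(1,2)] by blast
    obtain c B where B: "B \<in> sym_mats m" "mat_trace B \<noteq> 0" "peels (Suc m) 1 A (direct_sum (diag_list [c]) B)"
      "direct_sum (diag_list [c]) B \<notin> scalar_mats (Suc m)"
      using isotropic_reduction[OF qc two Suc.prems(1,3) _ v] False by blast
    have "\<exists>ys. length ys = m \<and> peels m (m - 1) B (diag_list ys) \<and> diag_list (c # ys) \<notin> scalar_mats (Suc m)"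
    proof (cases "B \<in> scalar_mats m")
      case True
      then obtain k where k: "B = diag_list (replicate m k)" by (rule scalar_diag_list)
      have "peels m (m - 1) B B" using peels_mono[OF two peels_refl[OF B(1)]] by simp
      then show ?thesis using k B(4) diag_list_append[of "[c]" "replicate m k"]
        by (intro exI[of _ "replicate m k"]) auto
    next
      case False
      then obtain ys where ys: "length ys = m" "peels m (m - 1) B (diag_list ys)" "diag_list ys \<notin> scalar_mats m"
        using Suc.IH[OF B(1)] B(2) by blast
      have "diag_list (c # ys) \<notin> scalar_mats (Suc m)"
      proof
        assume "diag_list (c # ys) \<in> scalar_mats (Suc m)"
        then have s: "bordered c (0\<^sub>v m) (diag_list ys) \<in> scalar_mats (Suc m)"
          using bordered_zero_direct_sum[of "diag_list ys" m c] diag_list_append[of "[c]" ys] diag_list_carrier[of ys] ys(1)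
          by simp
        have "ys ! i = c" if "i < m" for i
          using scalar_mats_index[OF s, of "Suc i" "Suc i"] that ys(1) by (simp add: diag_list_def mat_diag_def)
        then have "set ys \<subseteq> {c}" using ys(1) by (auto simp: set_conv_nth)
        then show False using diag_list_scalar[of ys c] ys(1,3) by simp
      qed
      with ys show ?thesis by blast
    qed
    then obtain ys where ys: "length ys = m" "peels m (m - 1) B (diag_list ys)" "diag_list (c # ys) \<notin> scalar_mats (Suc m)"
      by blast
    have "peels (1 + m) (m - 1) (direct_sum (diag_list [c]) B) (direct_sum (diag_list [c]) (diag_list ys))"
      using peels_mono[OF two peels_refl[OF diag_list_sym[of "[c]"]]] by (intro peels_direct_sum ys(2)) simp
    then have "peels (Suc m) (m - 1) (direct_sum (diag_list [c]) B) (diag_list (c # ys))"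
      using diag_list_append[of "[c]" ys] by simp
    then have "peels (Suc m) (1 + (m - 1)) A (diag_list (c # ys))" by (rule peels_trans[OF B(3)])
    then show ?thesis using ys False by (intro exI[of _ "c # ys"]) simp
  qed
qed

text \<open>The free corner becomes the trace of the new matrix. It also has to differ from the next
diagonal entry, so that the new matrix is nonscalar; one of the values \<open>1\<close> and \<open>- 1\<close> does.\<close>

lemma trace_correction:
  fixes A :: "'a::field mat"
  assumes qc: "quadratically_closed TYPE('a)" and two: "(2::'a) \<noteq> 0"
    and A: "A \<in> sym_mats n" "A \<notin> scalar_mats n" "mat_trace A = 0" and n: "3 \<le> n"
  obtains X where "peels n 1 A X" "X \<notin> scalar_mats n" "mat_trace X \<noteq> 0"
proof -
  obtain v where v: "v \<in> carrier_vec n" "v \<bullet> v \<noteq> 0" "v \<bullet> (A *\<^sub>v v) = 0"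
    using nonscalar_isotropic[OF qc two A(1,2)] n by blast
  obtain m where m: "n = Suc m" "0 < m" using n by (cases n) auto
  obtain P b B where P: "P \<in> orth (Suc m)" "b \<in> carrier_vec m" "B \<in> sym_mats m" "A = conjugate_by P (bordered 0 b B)"
    using isotropic_vector_bordered[OF qc two] A(1) v m(1) by blast
  have "mat_trace A = mat_trace (bordered 0 b B)"
    unfolding P(4) by (rule mat_trace_conjugate_by[OF P(1) sym_mats_carrier[OF bordered_sym[OF P(3)]]])
  then have trB: "mat_trace B = 0" using A(3) by (simp add: mat_trace_bordered)
  have "(1::'a) \<noteq> - 1" using two by (simp add: eq_neg_iff_add_eq_0)
  then obtain d :: 'a where d: "d \<noteq> 0" "d \<noteq> B $$ (0, 0)" by (metis neg_equal_0_iff_equal zero_neq_one)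
  let ?X = "bordered d (2 \<cdot>\<^sub>v b) B"
  have "peels n 1 A ?X"
    unfolding P(4) m(1) by (rule peels_conjugate_by[OF peels_bordered[OF two P(3,2)] P(1)])
  moreover have "?X \<notin> scalar_mats n"
    using scalar_mats_index[of ?X n 1 1] d(2) m sym_mats_carrier[OF P(3)] by auto
  moreover have "mat_trace ?X \<noteq> 0" using trB d(1) by (simp add: mat_trace_bordered)
  ultimately show ?thesis by (rule that)
qed

lemma nonscalar_peels_to_diagonal:
  fixes A :: "'a::field mat"
  assumes qc: "quadratically_closed TYPE('a)" and two: "(2::'a) \<noteq> 0"
    and A: "A \<in> sym_mats n" "A \<notin> scalar_mats n" and n: "3 \<le> n"
  obtains xs where "length xs = n" "peels n n A (diag_list xs)" "diag_list xs \<notin> scalar_mats n"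
proof -
  obtain X where X: "peels n 1 A X" "X \<notin> scalar_mats n" "mat_trace X \<noteq> 0"
  proof (cases "mat_trace A = 0")
    case True
    then show ?thesis using trace_correction[OF qc two A _ n] that by blast
  next
    case False
    then show ?thesis using peels_mono[OF two peels_refl[OF A(1)], of 1] A that by simp
  qed
  obtain xs where "length xs = n" "peels n (n - 1) X (diag_list xs)" "diag_list xs \<notin> scalar_mats n"
    using peels_to_diagonal[OF qc two _ X(2,3)] peels_sym[OF X(1)] by blast
  then show ?thesis using that[of xs] peels_trans[OF X(1), of "n - 1" "diag_list xs"] n by simp
qed

section \<open>Diagonalizable symmetric matrices\<close>

text \<open>The Gram matrix \<open>Q\<^sup>T Q\<close> of a spanning family is nonzero, so some \<open>q\<^sub>i \<bullet> q\<^sub>j\<close> is nonzero. Eigenvectors of a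
symmetric matrix for different eigenvalues are orthogonal, so \<open>q\<^sub>i\<close> and \<open>q\<^sub>j\<close> have the same
eigenvalue, and one of \<open>q\<^sub>i\<close>, \<open>q\<^sub>j\<close>, \<open>q\<^sub>i + q\<^sub>j\<close> is nonisotropic.\<close>

lemma nonisotropic_eigenvector:
  fixes A :: "'a::field mat"
  assumes two: "(2::'a) \<noteq> 0" and A: "A \<in> sym_mats n" and n: "0 < n"
    and Q: "Q \<in> carrier_mat n N" and R: "R \<in> carrier_mat N n" and QR: "Q * R = 1\<^sub>m n"
    and eig: "A * Q = Q * mat_diag N \<delta>"
  obtains v l where "v \<in> carrier_vec n" "v \<bullet> v \<noteq> 0" "A *\<^sub>v v = l \<cdot>\<^sub>v v"
proof -
  have Ac: "A \<in> carrier_mat n n" and At: "A\<^sup>T = A" using A by (simp_all add: sym_mats_def)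
  define q where "q i = col Q i" for i
  have q: "q i \<in> carrier_vec n" for i
    using carrier_matD(1)[OF Q] unfolding q_def by (intro carrier_vecI) simp
  have Aq: "A *\<^sub>v q i = \<delta> i \<cdot>\<^sub>v q i" if "i < N" for i
  proof -
    have "A *\<^sub>v q i = col (A * Q) i"
      unfolding q_def by (rule col_mult2[OF Ac Q that, symmetric])
    also have "\<dots> = \<delta> i \<cdot>\<^sub>v q i"
      unfolding eig mat_diag_mult_right[OF Q] q_def
      using that carrier_matD[OF Q] by (intro eq_vecI) (simp_all add: mult.commute)
    finally show ?thesis .
  qed
  have "\<exists>i<N. \<exists>j<N. q i \<bullet> q j \<noteq> 0"
  proof (rule ccontr)
    assume "\<not> ?thesis"
    then have "Q\<^sup>T * Q = 0\<^sub>m N N"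
      using carrier_matD[OF Q] unfolding q_def by (intro eq_matI) simp_all
    have Qt: "Q\<^sup>T \<in> carrier_mat N n" and Rt: "R\<^sup>T \<in> carrier_mat n N" using Q R by simp_all
    have "1\<^sub>m n = (Q * R)\<^sup>T * (Q * R)" by (simp add: QR)
    also have "\<dots> = R\<^sup>T * (Q\<^sup>T * (Q * R))"
      unfolding transpose_mult[OF Q R] by (rule assoc_mult_mat[OF Rt Qt mult_carrier_mat[OF Q R]])
    also have "Q\<^sup>T * (Q * R) = (Q\<^sup>T * Q) * R" by (rule assoc_mult_mat[OF Qt Q R, symmetric])
    also have "R\<^sup>T * \<dots> = 0\<^sub>m n n" unfolding \<open>Q\<^sup>T * Q = 0\<^sub>m N N\<close> using R by simp
    finally have "(1\<^sub>m n :: 'a mat) $$ (0, 0) = 0\<^sub>m n n $$ (0, 0)" by simp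
    then show False using n by simp
  qed
  then obtain i j where ij: "i < N" "j < N" "q i \<bullet> q j \<noteq> 0" by blast
  have "\<delta> i * (q i \<bullet> q j) = (A *\<^sub>v q i) \<bullet> q j"
    unfolding Aq[OF ij(1)] by (rule smult_scalar_prod_distrib[OF q q, symmetric])
  also have "\<dots> = q i \<bullet> (A *\<^sub>v q j)"
    using transpose_vec_mult_scalar[OF Ac q q, of i j] unfolding At by simp
  also have "\<dots> = \<delta> j * (q i \<bullet> q j)"
    unfolding Aq[OF ij(2)] by (rule scalar_prod_smult_distrib[OF q q])
  finally have d: "\<delta> i = \<delta> j" using ij(3) by simp
  consider "q i \<bullet> q i \<noteq> 0" | "q j \<bullet> q j \<noteq> 0" | "q i \<bullet> q i = 0" "q j \<bullet> q j = 0" by blast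
  then show ?thesis
  proof cases
    case 1
    then show ?thesis using that[OF q _ Aq[OF ij(1)]] by blast
  next
    case 2
    then show ?thesis using that[OF q _ Aq[OF ij(2)]] by blast
  next
    case 3
    have c: "q i + q j \<in> carrier_vec n" using q by simp
    have "(q i + q j) \<bullet> (q i + q j) = q i \<bullet> q j + q j \<bullet> q i"
      using 3 by (simp add: add_scalar_prod_distrib[OF q q c] scalar_prod_add_distrib[OF q q q])
    also have "\<dots> = 2 * (q i \<bullet> q j)" using comm_scalar_prod[OF q q, of j i] by simp
    finally have "(q i + q j) \<bullet> (q i + q j) \<noteq> 0" using two ij(3) by simp
    moreover have "A *\<^sub>v (q i + q j) = \<delta> j \<cdot>\<^sub>v (q i + q j)"
      unfolding mult_add_distrib_mat_vec[OF Ac q q] Aq[OF ij(1)] Aq[OF ij(2)] d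
      by (rule smult_add_distrib_vec[OF q q, symmetric])
    ultimately show ?thesis by (rule that[OF c])
  qed
qed

text \<open>The hypothesis asks for eigenvectors that span, not for a basis: deleting the first coordinate from the columns
of \<open>Q\<close> keeps a right inverse and the eigenvector equations for the remaining block, so the induction needs no
selection of a basis.\<close>

lemma spanning_eigenvectors_diagonalize:
  fixes A :: "'a::field mat"
  assumes qc: "quadratically_closed TYPE('a)" and two: "(2::'a) \<noteq> 0"
  shows "A \<in> sym_mats n \<Longrightarrow> Q \<in> carrier_mat n N \<Longrightarrow> R \<in> carrier_mat N n \<Longrightarrow> Q * R = 1\<^sub>m n \<Longrightarrow>
    A * Q = Q * mat_diag N \<delta> \<Longrightarrow> \<exists>xs. length xs = n \<and> peels n 0 A (diag_list xs)"
proof (induction n arbitrary: A Q R)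
  case 0
  have "A = diag_list []"
    using sym_mats_carrier[OF 0(1)] by (intro eq_matI) (auto simp: diag_list_def mat_diag_def)
  then show ?case using peels_refl[OF 0(1)] by (intro exI[of _ "[]"]) simp
next
  case (Suc m)
  note Q = Suc.prems(2) and R = Suc.prems(3)
  obtain v l where v: "v \<in> carrier_vec (Suc m)" "v \<bullet> v \<noteq> 0" "A *\<^sub>v v = l \<cdot>\<^sub>v v"
    using nonisotropic_eigenvector[OF two Suc.prems(1) _ Q R Suc.prems(4,5)] by blast
  obtain P B where P: "P \<in> orth (Suc m)" "B \<in> sym_mats m" "A = conjugate_by P (direct_sum (diag_list [l]) B)"
    by (rule eigenvector_direct_sum[OF qc two Suc.prems(1) v])
  have Pc: "P \<in> carrier_mat (Suc m) (Suc m)" and Bc: "B \<in> carrier_mat m m"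
    using P by (simp_all add: orth_carrier sym_mats_carrier)
  define A2 where "A2 = direct_sum (diag_list [l]) B"
  have A2: "A2 = bordered l (0\<^sub>v m) B" unfolding A2_def using bordered_zero_direct_sum[OF Bc] by metis
  then have A2s: "A2 \<in> sym_mats (Suc m)" using bordered_sym[OF P(2)] by simp
  then have A2c: "A2 \<in> carrier_mat (Suc m) (Suc m)" by (rule sym_mats_carrier)
  define Q2 where "Q2 = P\<^sup>T * Q"
  define R2 where "R2 = R * P"
  have Q2c: "Q2 \<in> carrier_mat (Suc m) N" and R2c: "R2 \<in> carrier_mat N (Suc m)"
    using Pc Q R by (simp_all add: Q2_def R2_def)
  have PP: "P\<^sup>T * P = 1\<^sub>m (Suc m)" using P(1) by (simp add: orth_def)
  have PtP: "P\<^sup>T \<in> carrier_mat (Suc m) (Suc m)" using Pc by simp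
  have "Q2 * R2 = P\<^sup>T * (Q * R) * P"
    unfolding Q2_def R2_def using Pc Q R
    by (simp add: assoc_mult_mat[OF PtP Q] assoc_mult_mat[OF PtP mult_carrier_mat[OF Q R] Pc]
        assoc_mult_mat[OF Q R Pc] assoc_mult_mat[OF PtP Q mult_carrier_mat[OF R Pc]])
  then have QR2: "Q2 * R2 = 1\<^sub>m (Suc m)" using Suc.prems(4) PP PtP by simp
  have "A2 * Q2 = (P\<^sup>T * A * P) * (P\<^sup>T * Q)"
    using conjugate_by_transpose_cancel(2)[OF P(1) A2c] unfolding P(3) A2_def[symmetric] Q2_def by (simp add: conjugate_by_def)
  also have "\<dots> = (P\<^sup>T * A) * (P * (P\<^sup>T * Q))"
    using sym_mats_carrier[OF Suc.prems(1)] PtP Pc Q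
    by (intro assoc_mult_mat[of _ "Suc m" "Suc m" _ "Suc m" _ N]) auto
  also have "P * (P\<^sup>T * Q) = Q"
    using assoc_mult_mat[OF Pc PtP Q] orth_right[OF P(1)] Q by simp
  also have "P\<^sup>T * A * Q = P\<^sup>T * (A * Q)"
    by (rule assoc_mult_mat[OF PtP sym_mats_carrier[OF Suc.prems(1)] Q])
  also have "\<dots> = Q2 * mat_diag N \<delta>"
    unfolding Suc.prems(5) Q2_def by (rule assoc_mult_mat[OF PtP Q mat_diag_dim, symmetric])
  finally have eig2: "A2 * Q2 = Q2 * mat_diag N \<delta>" .
  define Q3 where "Q3 = mat m N (\<lambda>(i, k). Q2 $$ (Suc i, k))"
  define R3 where "R3 = mat N m (\<lambda>(k, j). R2 $$ (k, Suc j))"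
  have "Q3 * R3 = 1\<^sub>m m"
  proof (rule eq_matI)
    fix i j assume "i < dim_row (1\<^sub>m m :: 'a mat)" "j < dim_col (1\<^sub>m m :: 'a mat)"
    then have ij: "i < m" "j < m" by auto
    then have "(Q3 * R3) $$ (i, j) = (Q2 * R2) $$ (Suc i, Suc j)"
      using Q2c R2c by (simp add: Q3_def R3_def scalar_prod_def)
    then show "(Q3 * R3) $$ (i, j) = 1\<^sub>m m $$ (i, j)" using ij by (simp add: QR2)
  qed (auto simp: Q3_def R3_def)
  moreover have "B * Q3 = Q3 * mat_diag N \<delta>"
  proof (rule eq_matI)
    fix i k assume "i < dim_row (Q3 * mat_diag N \<delta>)" "k < dim_col (Q3 * mat_diag N \<delta>)"
    then have ik: "i < m" "k < N" by (auto simp: Q3_def mat_diag_def)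
    have "(A2 * Q2) $$ (Suc i, k) = (\<Sum>j = 0..<Suc m. A2 $$ (Suc i, j) * Q2 $$ (j, k))"
      using ik A2c Q2c by (simp add: scalar_prod_def)
    also have "\<dots> = (\<Sum>j = 0..<m. B $$ (i, j) * Q2 $$ (Suc j, k))"
      unfolding A2 sum.atLeast0_lessThan_Suc_shift using ik Bc by simp
    also have "\<dots> = (B * Q3) $$ (i, k)"
      using ik Bc by (simp add: scalar_prod_def Q3_def)
    finally have "(B * Q3) $$ (i, k) = (A2 * Q2) $$ (Suc i, k)" by (rule sym)
    also have "\<dots> = Q2 $$ (Suc i, k) * \<delta> k"
      unfolding eig2 mat_diag_mult_right[OF Q2c] using ik by simp
    also have "\<dots> = (Q3 * mat_diag N \<delta>) $$ (i, k)"
      using ik by (subst mat_diag_mult_right[of _ m]) (simp_all add: Q3_def)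
    finally show "(B * Q3) $$ (i, k) = (Q3 * mat_diag N \<delta>) $$ (i, k)" .
  qed (use Bc in \<open>auto simp: Q3_def mat_diag_def\<close>)
  ultimately obtain xs where xs: "length xs = m" "peels m 0 B (diag_list xs)"
    using Suc.IH[of B Q3 R3] P(2) by (auto simp: Q3_def R3_def)
  have "peels (1 + m) 0 A2 (direct_sum (diag_list [l]) (diag_list xs))"
    unfolding A2_def using peels_refl[OF diag_list_sym[of "[l]"]] by (intro peels_direct_sum xs(2)) simp
  then have "peels (Suc m) 0 A2 (diag_list (l # xs))"
    using diag_list_append[of "[l]" xs] by simp
  then have "peels (Suc m) 0 A (diag_list (l # xs))"
    unfolding P(3) A2_def[symmetric] by (rule peels_conjugate_by[OF _ P(1)])
  then show ?case using xs(1) by (intro exI[of _ "l # xs"]) simp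
qed

lemma diagonalizable_orthogonally:
  fixes A :: "'a::field mat"
  assumes qc: "quadratically_closed TYPE('a)" and two: "(2::'a) \<noteq> 0"
    and A: "A \<in> sym_mats n" "diagonalizable_mat A"
  obtains xs where "length xs = n" "peels n 0 A (diag_list xs)"
proof -
  obtain D where D: "diagonal_mat D" "similar_mat A D" using A(2) by (auto simp: diagonalizable_mat_def)
  obtain n' P Q where *: "{A, D, P, Q} \<subseteq> carrier_mat n' n'" "P * Q = 1\<^sub>m n'" "Q * P = 1\<^sub>m n'" "A = P * D * Q"
    using similar_matD[OF D(2)] by blast
  have "n' = n" using *(1) sym_mats_carrier[OF A(1)] by auto
  then have c: "D \<in> carrier_mat n n" "P \<in> carrier_mat n n" "Q \<in> carrier_mat n n" and PQ: "P * Q = 1\<^sub>m n" "Q * P = 1\<^sub>m n"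
    using * by auto
  have "D = mat_diag n (\<lambda>i. D $$ (i, i))"
    using D(1) c(1) by (intro eq_matI) (auto simp: diagonal_mat_def mat_diag_def)
  moreover have "A * P = P * D"
    unfolding *(4) using c PQ by (simp add: assoc_mult_mat[of _ n n _ n _ n])
  ultimately have "A * P = P * mat_diag n (\<lambda>i. D $$ (i, i))" by simp
  from spanning_eigenvectors_diagonalize[OF qc two A(1) c(2,3) PQ(1) this] that show ?thesis by blast
qed

section \<open>Rank growth along words\<close>

text \<open>Rank at most \<open>r\<close>, expressed by a factorisation through dimension \<open>r\<close>; sums and products with
fixed matrices then follow from block multiplication.\<close>

definition rank_le :: "nat \<Rightarrow> nat \<Rightarrow> 'a::field mat \<Rightarrow> bool" where
  "rank_le n r M \<longleftrightarrow> (\<exists>U \<in> carrier_mat n r. \<exists>V \<in> carrier_mat r n. M = U * V)"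

lemma rank_le_mult:
  assumes "rank_le n r M" "B \<in> carrier_mat n n" "C \<in> carrier_mat n n"
  shows "rank_le n r (B * M * C)"
proof -
  obtain U V where U: "U \<in> carrier_mat n r" and V: "V \<in> carrier_mat r n" and M: "M = U * V"
    using assms(1) by (auto simp: rank_le_def)
  have "B * M * C = (B * U) * (V * C)"
    unfolding M assoc_mult_mat[OF assms(2) U V, symmetric]
    by (rule assoc_mult_mat[OF mult_carrier_mat[OF assms(2) U] V assms(3)])
  then show ?thesis using U V assms by (auto simp: rank_le_def intro!: bexI mult_carrier_mat)
qed

lemma rank_le_add:
  assumes "rank_le n r M" "rank_le n s N"
  shows "rank_le n (r + s) (M + N)"
proof -
  obtain U V where U: "U \<in> carrier_mat n r" "V \<in> carrier_mat r n" "M = U * V"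
    using assms(1) by (auto simp: rank_le_def)
  obtain W Z where W: "W \<in> carrier_mat n s" "Z \<in> carrier_mat s n" "N = W * Z"
    using assms(2) by (auto simp: rank_le_def)
  let ?L = "four_block_mat U W (0\<^sub>m 0 r) (0\<^sub>m 0 s)" and ?R = "four_block_mat V (0\<^sub>m r 0) Z (0\<^sub>m s 0)"
  have "?L * ?R = four_block_mat (U * V + W * Z) (U * 0\<^sub>m r 0 + W * 0\<^sub>m s 0)
      (0\<^sub>m 0 r * V + 0\<^sub>m 0 s * Z) (0\<^sub>m 0 r * 0\<^sub>m r 0 + 0\<^sub>m 0 s * 0\<^sub>m s 0)"
    using U W by (intro mult_four_block_mat[of _ n r _ s _ 0 _ _ n _ 0]) auto
  also have "\<dots> = M + N"
    using U W by (intro eq_matI) auto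
  finally have "M + N = ?L * ?R" by (rule sym)
  moreover have "?L \<in> carrier_mat (n + 0) (r + s)" "?R \<in> carrier_mat (r + s) (n + 0)"
    using U W by (auto intro!: four_block_carrier_mat)
  ultimately show ?thesis unfolding rank_le_def by auto
qed

text \<open>From \<open>U W = 1\<close> with inner dimension \<open>r < n\<close>, padding by zeros gives square matrices with \<open>U' W' = 1\<close>,
hence \<open>W' U' = 1\<close>, although row \<open>r\<close> of \<open>W'\<close> is zero.\<close>

lemma rank_le_invertible:
  assumes "rank_le n r M" "M' \<in> carrier_mat n n" "M * M' = 1\<^sub>m n"
  shows "n \<le> r"
proof (rule ccontr)
  assume "\<not> n \<le> r"
  then have rn: "r < n" by simp
  obtain U V where U: "U \<in> carrier_mat n r" and V: "V \<in> carrier_mat r n" and M: "M = U * V"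
    using assms(1) by (auto simp: rank_le_def)
  define W where "W = V * M'"
  have W: "W \<in> carrier_mat r n" using V assms(2) by (simp add: W_def)
  have UW: "U * W = 1\<^sub>m n"
    using assms(3) unfolding M W_def assoc_mult_mat[OF U V assms(2)] .
  define U' where "U' = mat n n (\<lambda>(i, j). if j < r then U $$ (i, j) else 0)"
  define W' where "W' = mat n n (\<lambda>(i, j). if i < r then W $$ (i, j) else 0)"
  have "U' * W' = 1\<^sub>m n"
  proof (rule eq_matI)
    fix i j assume "i < dim_row (1\<^sub>m n :: 'a mat)" "j < dim_col (1\<^sub>m n :: 'a mat)"
    then have ij: "i < n" "j < n" by auto
    have "(U' * W') $$ (i, j) = (\<Sum>k = 0..<n. if k < r then U $$ (i, k) * W $$ (k, j) else 0)"
      using ij by (simp add: U'_def W'_def scalar_prod_def) (intro sum.cong; simp)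
    also have "\<dots> = (\<Sum>k = 0..<r. U $$ (i, k) * W $$ (k, j))"
      using rn by (intro sum.mono_neutral_cong_right) auto
    also have "\<dots> = (U * W) $$ (i, j)" using ij U W by (simp add: scalar_prod_def)
    finally show "(U' * W') $$ (i, j) = 1\<^sub>m n $$ (i, j)" by (simp add: UW)
  qed (auto simp: U'_def W'_def)
  then have "W' * U' = 1\<^sub>m n"
    by (rule mat_mult_left_right_inverse[rotated 2]) (auto simp: U'_def W'_def)
  then have "(W' * U') $$ (r, r) = 1" using rn by simp
  moreover have "(W' * U') $$ (r, r) = 0"
    using rn by (simp add: U'_def W'_def scalar_prod_def)
  ultimately show False by simp
qed

lemma complement_idempotent:
  fixes e :: "'a::field mat"
  assumes "e \<in> carrier_mat n n" "e * e = e"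
  shows "(1\<^sub>m n - e) * e = 0\<^sub>m n n" "e * (1\<^sub>m n - e) = 0\<^sub>m n n"
    "(1\<^sub>m n - e) * (1\<^sub>m n - e) = 1\<^sub>m n - e"
proof -
  show 1: "(1\<^sub>m n - e) * e = 0\<^sub>m n n"
    using assms by (subst minus_mult_distrib_mat[of _ n n _ _ n]) simp_all
  show 2: "e * (1\<^sub>m n - e) = 0\<^sub>m n n"
    using assms by (subst mult_minus_distrib_mat[of _ n n _ n]) simp_all
  have "(1\<^sub>m n - e) * (1\<^sub>m n - e) = (1\<^sub>m n - e) * 1\<^sub>m n - (1\<^sub>m n - e) * e"
    using assms(1) by (intro mult_minus_distrib_mat[of _ n n _ n]) auto
  also have "\<dots> = 1\<^sub>m n - e" unfolding 1 using assms(1) by (intro eq_matI) auto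
  finally show "(1\<^sub>m n - e) * (1\<^sub>m n - e) = 1\<^sub>m n - e" .
qed

lemma sym_idempotentsD:
  assumes "(2::'a::field) \<noteq> 0" "(e :: 'a mat) \<in> sym_idempotents n"
  shows "e \<in> carrier_mat n n" "e * e = e"
  using assms(2) jordan_mult_self[OF assms(1), of e n] by (auto simp: idempotents_def sym_mats_def)

lemma compression_zero:
  fixes x :: "'a::field mat"
  assumes "x \<in> carrier_mat n n" "e \<in> carrier_mat n n" "e * e = e"
  shows "(1\<^sub>m n - e) * jordan_mult x e * (1\<^sub>m n - e) = 0\<^sub>m n n"
proof -
  let ?f = "1\<^sub>m n - e"
  have f: "?f \<in> carrier_mat n n" using assms(2) by (simp add: minus_carrier_mat)
  have "x * e \<in> carrier_mat n n" "e * x \<in> carrier_mat n n" "?f * (x * e + e * x) \<in> carrier_mat n n"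
    "?f * (x * e) \<in> carrier_mat n n" "?f * (e * x) \<in> carrier_mat n n"
    "e * ?f \<in> carrier_mat n n" "x * ?f \<in> carrier_mat n n"
    using assms(1,2) f by (auto intro!: mult_carrier_mat[of _ n n])
  note [simp] = assms(1,2) f this
  have "?f * jordan_mult x e * ?f = (1 / 2) \<cdot>\<^sub>m (?f * (x * e + e * x) * ?f)"
    by (simp add: jordan_mult_def mult_smult_distrib[of _ n n _ n] mult_smult_assoc_mat[of _ n n _ n])
  also have "?f * (x * e + e * x) * ?f = ?f * (x * e) * ?f + ?f * (e * x) * ?f"
    by (simp add: mult_add_distrib_mat[of _ n n _ n] add_mult_distrib_mat[of _ n n _ _ n])
  also have "?f * (x * e) * ?f = ?f * x * (e * ?f)"
    by (simp add: assoc_mult_mat[of _ n n _ n _ n])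
  also have "?f * (e * x) * ?f = (?f * e) * (x * ?f)"
    by (simp add: assoc_mult_mat[of _ n n _ n _ n])
  moreover have fx: "?f * x \<in> carrier_mat n n" and xf: "x * ?f \<in> carrier_mat n n" by (rule mult_carrier_mat[OF f assms(1)], rule mult_carrier_mat[OF assms(1) f])
  ultimately show ?thesis
    unfolding complement_idempotent[OF assms(2,3)] right_mult_zero_mat[OF fx] left_mult_zero_mat[OF xf] by simp
qed

text \<open>Put \<open>M = x \<circ> e + 1\<close> and \<open>f = 1 - e\<close>. As \<open>f (x \<circ> e) f = 0\<close>, we have \<open>f M f = f\<close>, which recovers the
rows of \<open>x + 1\<close> in the range of \<open>f\<close>; the other rows are recovered by \<open>e M (2 - e) = e x + e\<close>, where the factor
\<open>2 - e\<close> undoes the halving. Thus \<open>x + 1 = e M (2 - e) + f M f (x + 1)\<close>.\<close>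

lemma rank_doubling:
  fixes x :: "'a::field mat"
  assumes two: "(2::'a) \<noteq> 0" and x: "x \<in> carrier_mat n n" and e: "e \<in> carrier_mat n n" "e * e = e"
    and r: "rank_le n r (jordan_mult x e + 1\<^sub>m n)"
  shows "rank_le n (2 * r) (x + 1\<^sub>m n)"
proof -
  let ?f = "1\<^sub>m n - e" and ?A = "jordan_mult x e"
  let ?M = "?A + 1\<^sub>m n" and ?T = "2 \<cdot>\<^sub>m 1\<^sub>m n - e"
  have f: "?f \<in> carrier_mat n n" and T: "?T \<in> carrier_mat n n" using e(1) by (simp_all add: minus_carrier_mat)
  have A: "?A \<in> carrier_mat n n" using x e(1) by (simp add: jordan_mult_def)
  have "x * e \<in> carrier_mat n n" "e * x \<in> carrier_mat n n" "e * x * e \<in> carrier_mat n n"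
    "e * (x * e) \<in> carrier_mat n n" "e * ?M \<in> carrier_mat n n" "e * ?A \<in> carrier_mat n n"
    "e * ?M * e \<in> carrier_mat n n" "?f * ?M \<in> carrier_mat n n" "?f * ?A \<in> carrier_mat n n"
    using x e(1) f A by (auto intro!: mult_carrier_mat[of _ n n])
  note [simp] = x e(1) f A T this right_mult_one_mat[OF e(1)] right_mult_one_mat[OF f]
  have eee: "e * (e * x) = e * x" using e(2) by (simp flip: assoc_mult_mat[of _ n n _ n _ n])
  have eA: "e * ?A = (1 / 2) \<cdot>\<^sub>m (e * x * e + e * x)"
    by (simp add: jordan_mult_def mult_smult_distrib[of _ n n _ n] mult_add_distrib_mat[of _ n n _ n]
        assoc_mult_mat[of _ n n _ n _ n] eee)
  have "e * ?A * e = (1 / 2) \<cdot>\<^sub>m (e * x * e + e * x * e)"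
    unfolding eA using e(2)
    by (simp add: mult_smult_assoc_mat[of _ n n _ n] add_mult_distrib_mat[of _ n n _ _ n] assoc_mult_mat[of _ n n _ n _ n])
  also have "\<dots> = e * x * e"
    using two by (intro eq_matI) (simp_all del: index_mult_mat(1))
  finally have eAe: "e * ?A * e = e * x * e" .
  have eM: "e * ?M = e * ?A + e" by (simp add: mult_add_distrib_mat[of _ n n _ n])
  have eMe: "e * ?M * e = e * x * e + e"
    unfolding eM using e(2) eAe by (simp add: add_mult_distrib_mat[of _ n n _ _ n])
  have halve: "2 \<cdot>\<^sub>m ((1 / 2) \<cdot>\<^sub>m (G + H) + e) - (G + e) = H + e"
    if "G \<in> carrier_mat n n" "H \<in> carrier_mat n n" for G H
    using carrier_matD[OF that(1)] carrier_matD[OF that(2)] carrier_matD[OF e(1)] two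
    by (intro eq_matI) (simp_all add: field_simps)
  have "e * ?M * ?T = e * ?M * (2 \<cdot>\<^sub>m 1\<^sub>m n) - e * ?M * e"
    by (intro mult_minus_distrib_mat[of _ n n _ n]) auto
  also have "e * ?M * (2 \<cdot>\<^sub>m 1\<^sub>m n) = 2 \<cdot>\<^sub>m (e * ?M)"
    by (subst mult_smult_distrib[of _ n n _ n]) auto
  also have "2 \<cdot>\<^sub>m (e * ?M) - e * ?M * e = e * x + e"
    unfolding eMe unfolding eM eA by (rule halve) simp_all
  finally have 1: "e * ?M * ?T = e * x + e" .
  have "?f * ?M * ?f = (?f * ?A + ?f) * ?f"
    by (simp add: mult_add_distrib_mat[of _ n n _ n])
  also have "\<dots> = ?f * ?A * ?f + ?f * ?f"
    by (intro add_mult_distrib_mat[of _ n n _ _ n]) auto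
  also have "\<dots> = ?f" unfolding compression_zero[OF x e] complement_idempotent(3)[OF e] by simp
  finally have "?f * ?M * (?f * (x + 1\<^sub>m n)) = ?f * (x + 1\<^sub>m n)"
    by (simp flip: assoc_mult_mat[of _ n n _ n _ n])
  also have "\<dots> = x + 1\<^sub>m n - e * (x + 1\<^sub>m n)"
    by (subst minus_mult_distrib_mat[of _ n n _ _ n]) auto
  also have "e * (x + 1\<^sub>m n) = e * x + e" by (simp add: mult_add_distrib_mat[of _ n n _ n])
  finally have 2: "?f * ?M * (?f * (x + 1\<^sub>m n)) = x + 1\<^sub>m n - (e * x + e)" .
  have add_diff: "G + (H - G) = H" if "G \<in> carrier_mat n n" "H \<in> carrier_mat n n" for G H :: "'a mat"
    using carrier_matD[OF that(1)] carrier_matD[OF that(2)] by (intro eq_matI) simp_all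
  have "rank_le n (r + r) (e * ?M * ?T + ?f * ?M * (?f * (x + 1\<^sub>m n)))"
    by (intro rank_le_add rank_le_mult r) (auto intro!: mult_carrier_mat[OF f])
  also have "e * ?M * ?T + ?f * ?M * (?f * (x + 1\<^sub>m n)) = x + 1\<^sub>m n"
    unfolding 1 2 by (rule add_diff) simp_all
  finally show ?thesis by (simp add: mult_2)
qed

text \<open>An idempotent satisfies \<open>(e + 1) (1 - e / 2) = 1\<close>, so for words of length one the rank of \<open>A + 1\<close> is full.\<close>

lemma word_rank_bound:
  fixes A :: "'a::field mat"
  assumes two: "(2::'a) \<noteq> 0" and "idem_word_value (sym_mats n) jordan_mult m A"
  shows "rank_le n r (A + 1\<^sub>m n) \<Longrightarrow> 1 \<le> m \<and> n \<le> 2 ^ (m - 1) * r"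
  using assms(2)
proof (induction arbitrary: r rule: idem_word_induct)
  case (idempotent e)
  note e = sym_idempotentsD[OF two idempotent(1)]
  have half: "(1 / 2) \<cdot>\<^sub>m e \<in> carrier_mat n n" using e by simp
  have ee: "e + 1\<^sub>m n \<in> carrier_mat n n" using e by simp
  have "(e + 1\<^sub>m n) * (1\<^sub>m n - (1 / 2) \<cdot>\<^sub>m e) = (e + 1\<^sub>m n) * 1\<^sub>m n - (e + 1\<^sub>m n) * ((1 / 2) \<cdot>\<^sub>m e)"
    by (intro mult_minus_distrib_mat[OF ee _ half]) simp
  also have "(e + 1\<^sub>m n) * ((1 / 2) \<cdot>\<^sub>m e) = (1 / 2) \<cdot>\<^sub>m (e + e)"
    using e by (simp add: mult_smult_distrib[OF ee e(1)] add_mult_distrib_mat[of _ n n _ _ n])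
  also have "(e + 1\<^sub>m n) * 1\<^sub>m n - (1 / 2) \<cdot>\<^sub>m (e + e) = 1\<^sub>m n"
    using e(1) two by (simp add: right_mult_one_mat[OF ee]) (intro eq_matI; simp)
  finally have "n \<le> r"
    using idempotent(2) half by (intro rank_le_invertible[of n r "e + 1\<^sub>m n"]) (auto simp: minus_carrier_mat)
  then show ?case by simp
next
  case (snoc m x e)
  note e = sym_idempotentsD[OF two snoc(2)]
  have "x \<in> carrier_mat n n" using idem_word_sym[OF snoc(1)] by (rule sym_mats_carrier)
  from rank_doubling[OF two this e snoc.prems] have "1 \<le> m \<and> n \<le> 2 ^ (m - 1) * (2 * r)" by (rule snoc.IH)
  then show ?case by (cases m) auto
qed

section \<open>Scalar values\<close>

text \<open>If \<open>x \<circ> e = c 1\<close> with \<open>c \<noteq> 0\<close>, then compressing by \<open>1 - e\<close> gives \<open>e = 1\<close>, so the shorter word already has the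
value \<open>c 1\<close>.\<close>

lemma scalar_word:
  fixes A :: "'a::field mat"
  assumes two: "(2::'a) \<noteq> 0" and "idem_word_value (sym_mats n) jordan_mult m A"
  shows "A \<in> scalar_mats n \<Longrightarrow> A \<in> {0\<^sub>m n n, 1\<^sub>m n}"
  using assms(2)
proof (induction rule: idem_word_induct)
  case (idempotent e)
  note e = sym_idempotentsD[OF two idempotent(1)]
  obtain c where c: "e = c \<cdot>\<^sub>m 1\<^sub>m n" using idempotent(2) by (auto simp: scalar_mats_def)
  show ?case
  proof (cases "n = 0")
    case True
    then show ?thesis using e(1) by auto
  next
    case False
    have "c * c = (e * e) $$ (0, 0)" unfolding c using False
      by (simp add: mult_smult_distrib[of _ n n _ n] mult_smult_assoc_mat[of _ n n _ n] del: index_mult_mat(1))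
    also have "\<dots> = c" unfolding e(2) unfolding c using False by simp
    finally have "c * c = c" .
    then have "c = 0 \<or> c = 1" by simp
    then show ?thesis using c by (auto intro!: eq_matI)
  qed
next
  case (snoc m x e)
  note e = sym_idempotentsD[OF two snoc(2)]
  have x: "x \<in> carrier_mat n n" using idem_word_sym[OF snoc(1)] by (rule sym_mats_carrier)
  obtain c where c: "jordan_mult x e = c \<cdot>\<^sub>m 1\<^sub>m n" using snoc.prems by (auto simp: scalar_mats_def)
  let ?f = "1\<^sub>m n - e"
  have f: "?f \<in> carrier_mat n n" using e(1) by (simp add: minus_carrier_mat)
  have "c \<cdot>\<^sub>m ?f = ?f * (c \<cdot>\<^sub>m 1\<^sub>m n) * ?f"
    using f carrier_matD[OF e(1)] complement_idempotent(3)[OF e]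
    by (simp add: mult_smult_distrib[of _ n n _ n] mult_smult_assoc_mat[of _ n n _ n])
  also have "\<dots> = 0\<^sub>m n n" using compression_zero[OF x e] unfolding c .
  finally have cf: "c \<cdot>\<^sub>m ?f = 0\<^sub>m n n" .
  show ?case
  proof (cases "c = 0")
    case True
    then have "jordan_mult x e = 0\<^sub>m n n" unfolding c by (intro eq_matI) auto
    then show ?thesis by simp
  next
    case False
    have "e = 1\<^sub>m n"
    proof (rule eq_matI)
      fix i j assume ij: "i < dim_row (1\<^sub>m n :: 'a mat)" "j < dim_col (1\<^sub>m n :: 'a mat)"
      have "(c \<cdot>\<^sub>m ?f) $$ (i, j) = 0" unfolding cf using ij by simp
      then show "e $$ (i, j) = 1\<^sub>m n $$ (i, j)" using ij e(1) False by auto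
    qed (use e(1) in auto)
    then have "jordan_mult x e = x" using jordan_mult_one[OF two x] by simp
    then show ?thesis using snoc.IH snoc.prems by simp
  qed
qed

section \<open>Words in the algebra of symmetric matrices\<close>

lemma idem_length_le: "idem_word_value J f m x \<Longrightarrow> m \<le> k \<Longrightarrow> idem_length J f x \<le> enat k"
  unfolding idem_length_def by (rule INF_lower2[of m]) auto

lemma le_power_ceiling_log: "0 < n \<Longrightarrow> n \<le> 2 ^ nat \<lceil>log 2 (real n)\<rceil>"
proof -
  assume n: "0 < n"
  have "real n = 2 powr log 2 (real n)" using n by simp
  also have "\<dots> \<le> 2 powr real (nat \<lceil>log 2 (real n)\<rceil>)"
    by (intro powr_mono real_nat_ceiling_ge) simp
  also have "\<dots> = real (2 ^ nat \<lceil>log 2 (real n)\<rceil>)" by (simp add: powr_realpow)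
  finally show ?thesis by (simp only: of_nat_le_iff)
qed

lemma ceiling_log_le:
  assumes "0 < n" "n \<le> 2 ^ k"
  shows "nat \<lceil>log 2 (real n)\<rceil> \<le> k"
proof -
  have "real n \<le> 2 ^ k" using assms(2) by (metis of_nat_le_iff of_nat_numeral of_nat_power)
  then have "log 2 (real n) \<le> real k" using assms(1) by (simp add: log_le_iff powr_realpow)
  then show ?thesis by (simp add: ceiling_le_iff)
qed

theorem theorem5p4:
  fixes n :: nat
  assumes "quadratically_closed TYPE('a::field)"
    and "CHAR('a) \<noteq> 2"
    and "n \<ge> 3"
  shows "idem_products (sym_mats n) jordan_mult
           = (sym_mats n - scalar_mats n) \<union> {0\<^sub>m n n, 1\<^sub>m n :: 'a mat}
       \<and> enat (1 + nat \<lceil>log 2 (real n)\<rceil>)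
           \<le> idem_width (sym_mats n :: 'a mat set) jordan_mult
       \<and> idem_width (sym_mats n :: 'a mat set) jordan_mult \<le> enat (4 * n - 4)
       \<and> (\<forall>A :: 'a mat. A \<in> sym_mats n - scalar_mats n \<and> diagonalizable_mat A \<longrightarrow>
             idem_length (sym_mats n) jordan_mult A \<le> enat (3 * nat \<lceil>log 2 (real n)\<rceil>))"
proof -
  note qc = assms(1) and n = assms(3)
  have two: "(2::'a) \<noteq> 0"
  proof
    assume "(2::'a) = 0"
    then have "of_nat 2 = (0::'a)" by simp
    then have "CHAR('a) dvd 2" by (simp only: of_nat_eq_0_iff_char_dvd)
    then have "CHAR('a) = 1" using assms(2) by (metis One_nat_def prime_nat_iff two_is_prime_nat)
    then have "of_nat 1 = (0::'a)" by (metis of_nat_CHAR)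
    then show False by simp
  qed
  define K where "K = nat \<lceil>log 2 (real n)\<rceil>"
  have nK: "n \<le> 2 ^ K" unfolding K_def using n by (intro le_power_ceiling_log) simp
  have "K \<noteq> 0" using nK n by (cases K) auto
  then obtain j where j: "K = Suc j" by (cases K) auto
  have "n - 1 < 2 ^ (n - 1)" by (rule less_exp)
  then have "n \<le> 2 ^ (n - 1)" by linarith
  then have Kn: "K \<le> n - 1" unfolding K_def using n by (intro ceiling_log_le) auto
  let ?W = "idem_word_value (sym_mats n :: 'a mat set) jordan_mult"
  let ?ns = "sym_mats n - scalar_mats n :: 'a mat set"
  have nonconst: "\<nexists>c. set xs \<subseteq> {c}" if "diag_list xs \<notin> scalar_mats n" "length xs = n" for xs :: "'a list"
    using that diag_list_scalar by blast
  have diag_word: "?W (k + 2 * K + 1) A"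
    if "peels n k A (diag_list xs)" "diag_list xs \<notin> scalar_mats n" "length xs = n" for k A xs
    using nonconstant_idem_word[OF qc two nonconst[OF that(2,3)], of j k A] that nK unfolding j by simp
  have general: "?W (n + 2 * K + 1) A" if "A \<in> ?ns" for A
    using nonscalar_peels_to_diagonal[OF qc two _ _ n] diag_word that by (metis DiffD1 DiffD2)
  have diagonalizable: "?W (2 * K + 1) A" if A: "A \<in> ?ns" "diagonalizable_mat A" for A
  proof -
    obtain xs where xs: "length xs = n" "peels n 0 A (diag_list xs)"
      using diagonalizable_orthogonally[OF qc two _ A(2)] A(1) by blast
    then obtain P where P: "P \<in> orth n" "A = conjugate_by P (diag_list xs)" by (auto simp: peels.simps)
    then have "diag_list xs \<notin> scalar_mats n"
      using A(1) conjugate_by_scalar_iff[OF P(1), of "diag_list xs"] diag_list_carrier[of xs] xs(1) by auto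
    then show ?thesis using diag_word[OF xs(2) _ xs(1)] by simp
  qed
  have zero: "?W 1 (0\<^sub>m n n)" and one: "?W 1 (1\<^sub>m n)"
  proof -
    have "0\<^sub>m n n \<in> (sym_idempotents n :: 'a mat set)"
      using jordan_mult_self[OF two, of "0\<^sub>m n n" n] by (simp add: idempotents_def sym_mats_def)
    then show "?W 1 (0\<^sub>m n n)" by (auto simp: idem_word_value_def)
    show "?W 1 (1\<^sub>m n)" using one_idempotent[OF two] by (auto simp: idem_word_value_def)
  qed
  have products: "idem_products (sym_mats n) jordan_mult = ?ns \<union> {0\<^sub>m n n, 1\<^sub>m n}"
  proof (intro equalityI subsetI)
    fix A :: "'a mat" assume "A \<in> idem_products (sym_mats n) jordan_mult"
    then obtain m where "?W m A" by (auto simp: idem_products_def)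
    then show "A \<in> ?ns \<union> {0\<^sub>m n n, 1\<^sub>m n}" using idem_word_sym scalar_word[OF two] by blast
  next
    fix A assume "A \<in> ?ns \<union> {0\<^sub>m n n, 1\<^sub>m n}"
    then show "A \<in> idem_products (sym_mats n) jordan_mult"
      using general zero one unfolding idem_products_def by blast
  qed
  have upper: "idem_width (sym_mats n :: 'a mat set) jordan_mult \<le> enat (4 * n - 4)"
    unfolding idem_width_def products
  proof (rule SUP_least)
    fix A assume "A \<in> ?ns \<union> {0\<^sub>m n n, 1\<^sub>m n}"
    then obtain m where "?W m A" "m \<le> 4 * n - 4"
    proof (elim UnE insertE emptyE)
      assume "A \<in> ?ns"
      \<comment> \<open>From \<open>K \<le> n - 1\<close> this amounts to \<open>2 (n - 1) \<le> 3 n - 5\<close>, which is \<open>n \<ge> 3\<close>.\<close>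
      moreover have "n + 2 * K + 1 \<le> 4 * n - 4" using Kn n by linarith
      ultimately show thesis using general that by blast
    qed (use zero one n that in auto)
    then show "idem_length (sym_mats n) jordan_mult A \<le> enat (4 * n - 4)" by (rule idem_length_le)
  qed
  have lower: "enat (1 + K) \<le> idem_width (sym_mats n :: 'a mat set) jordan_mult"
  proof -
    \<comment> \<open>The eigenvalue \<open>- 1\<close> of multiplicity \<open>n - 1\<close> makes \<open>A + 1\<close> a matrix of rank one.\<close>
    define xs where "xs = (0::'a) # replicate (n - 1) (- 1)"
    have len: "length xs = n" using n by (simp add: xs_def)
    define A where "A = diag_list xs"
    have Ac: "A \<in> carrier_mat n n" unfolding A_def using diag_list_carrier[of xs] len by simp
    have As: "A \<in> sym_mats n" unfolding A_def using diag_list_sym[of xs] len by simp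
    have "A $$ (0, 0) \<noteq> A $$ (1, 1)"
      using n by (simp add: A_def xs_def diag_list_def mat_diag_def)
    then have "A \<notin> scalar_mats n" using scalar_mats_index[of A n 1 1] n by auto
    then have A: "A \<in> idem_products (sym_mats n) jordan_mult" unfolding products using As by simp
    define U where "U = mat n 1 (\<lambda>(i, _). if i = 0 then 1 else 0 :: 'a)"
    have "A + 1\<^sub>m n = U * U\<^sup>T"
      using n by (intro eq_matI)
        (auto simp: A_def U_def xs_def diag_list_def mat_diag_def scalar_prod_def nth_Cons')
    then have f: "rank_le n 1 (A + 1\<^sub>m n)"
      unfolding rank_le_def by (intro bexI[of _ U] bexI[of _ "U\<^sup>T"]) (auto simp: U_def)
    have "enat (1 + K) \<le> idem_length (sym_mats n) jordan_mult A"
      unfolding idem_length_def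
    proof (rule INF_greatest)
      fix m assume "m \<in> {m. ?W m A}"
      then have "1 \<le> m \<and> n \<le> 2 ^ (m - 1) * 1" using word_rank_bound[OF two _ f] by blast
      then have m: "1 \<le> m" "n \<le> 2 ^ (m - 1)" by simp_all
      then have "K \<le> m - 1" unfolding K_def using n by (intro ceiling_log_le) simp_all
      with m(1) show "enat (1 + K) \<le> enat m" by simp
    qed
    also have "\<dots> \<le> idem_width (sym_mats n :: 'a mat set) jordan_mult"
      unfolding idem_width_def by (rule SUP_upper[OF A])
    finally show ?thesis .
  qed
  have "idem_length (sym_mats n) jordan_mult A \<le> enat (3 * K)" if "A \<in> ?ns" "diagonalizable_mat A" for A
    using idem_length_le[OF diagonalizable[OF that]] j by simp
  then show ?thesis using products upper lower unfolding K_def by blast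
qed

end
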